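(* Let $\{x^k\}$ be generated by the momentum-based stochastic Bregman proximal gradient method (MSBPG) described in the context. Suppose the basic requirements and the noise requirement of the context hold, and suppose there exists $\kappa>0$ such that $\|\nabla F(x)-\nabla F(y)\|^2\le\kappa D_\phi(x,y)$ for all $x\in\mathrm{dom}\,\phi$, $y\in\mathrm{int\,dom}\,\phi$. Let $\alpha_k=c\mu\beta_{k+1}$ for any $c\in\big(0,\frac1{2\sqrt{\mu\kappa}}\big]$. Then $$\mathbb{E}\big[\|\widetilde{\mathcal G}_{\alpha_r}(x^{r})\|^2\big]\le\frac{\Delta_0+c\|v^0-\nabla F(x^0)\|^2+\sum_{k=0}^{N-1}\frac{\alpha_k^2\sigma^2}{c\mu^2m_k}}{\sum_{k=0}^{N-1}\frac{\mu\alpha_k}{8}},$$ where $\Delta_0=\Phi(x^0)-\Phi^*$, $\Phi^*=\inf_{\overline C}\Phi$, $N$ is the number of iterations, and $r$ is a random variable with distribution $\mathbb{P}\{r=k\}=\frac{\alpha_k}{\sum_{j=0}^{N-1}\alpha_j}$ for $k=0,\dots,N-1$.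
   Context: Problem: minimize $\Phi(x)=F(x)+R(x)$ over $x\in\overline C$, where $C\subset\mathbb{R}^d$ is nonempty, convex and open, and $F(x)=\mathbb{E}_{\xi}[f(x,\xi)]$ with $f(\cdot,\xi)$ differentiable and possibly nonconvex. Kernel functions: $\phi:\mathbb{R}^d\to(-\infty,+\infty]$ belongs to $\mathcal M(C)$ if it is proper, lower semicontinuous, convex, $\mathrm{dom}\,\phi\subset\overline C$, $\mathrm{dom}\,\partial\phi=C=\mathrm{int\,dom}\,\phi$, and $\phi$ is $C^1$ on $C$. Its Bregman distance is $D_\phi(x,y)=\phi(x)-\phi(y)-\langle\nabla\phi(y),x-y\rangle$ for $x\in\mathrm{dom}\,\phi$, $y\in\mathrm{int\,dom}\,\phi$. $\phi$ is a Legendre kernel if $\mathrm{int\,dom}\,\phi\ne\emptyset$, $\phi$ is differentiable and strictly convex there, $\|\nabla\phi(x^k)\|\to\infty$ whenever $x^k$ converges to a boundary point of $\mathrm{dom}\,\phi$, and $\phi(x)/\|x\|\to\infty$ as $\|x\|\to\infty$. $F$ is $L$-smooth adaptable with respect to $\phi$ if $L\phi+F$ and $L\phi-F$ are convex on $C$. Basic requirements: (A1) $F$ is proper, lower semicontinuous, $\mathrm{dom}\,\phi\subset\mathrm{dom}\,F$, and $F$ is $C^1$ on $\mathrm{int}\,C$. (A2) $\phi\in\mathcal M(C)$ is a Legendre kernel, $\mu$-strongly convex for some $\mu>0$, and $F$ is $L_F$-smooth adaptable with respect to $\phi$. (A3) $R$ is proper, lower semicontinuous and convex with $\mathrm{dom}\,R\cap\mathrm{int}\,C\neq\emptyset$.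 (A4) $\inf_{\overline C}\Phi>-\infty$. MSBPG: starting from $x^0$ and an initial gradient estimator $v^0$, with stepsizes $\alpha_k>0$ and momentum parameters $\beta_k\in(0,1)$, the gradient estimator is the stochastic moving average $v^k=(1-\beta_k)v^{k-1}+\beta_k\widetilde\nabla_k$, and $$x^{k+1}=\mathrm{argmin}_{x\in\overline C}\;R(x)+\langle v^k,x-x^k\rangle+\tfrac1{\alpha_k}D_\phi(x,x^k).$$ Here $\{\mathcal F_k\}$ is a filtration, $x^k$ is $\mathcal F_k$-measurable and the stochastic gradient $\widetilde\nabla_k$ is $\mathcal F_{k+1}$-measurable. Noise requirement: $\mathbb{E}[\widetilde\nabla_k|\mathcal F_k]=\nabla F(x^k)$ and $\mathbb{E}[\|\widetilde\nabla_k-\nabla F(x^k)\|^2|\mathcal F_k]\le\frac{\sigma^2}{m_k}$, where $m_k$ is the size of the mini-batch in the $k$-th iteration. Stochastic Bregman gradient mapping (with estimator $v^k$): $$\widetilde{\mathcal G}_{\alpha_k}(x^k)=\frac{x^k-\mathrm{Prox}^\phi_{\alpha_kR}\big(\nabla\phi^*(\nabla\phi(x^k)-\alpha_kv^k)\big)}{\alpha_k},\quad \mathrm{Prox}^\phi_{\alpha R}(x)=\mathrm{argmin}_{u\in\overline C}\{\alpha R(u)+D_\phi(u,x)\},$$ with $\phi^*$ the Fenchel conjugate of $\phi$.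
   Formalization: As printed (m_k in the noise sum, arbitrary batch sizes) the bound is false; it is proved with m_{k+1} in place of m_k for all batch sizes, and with m_k as printed when batch sizes do not decrease over the N iterations (m_k ≤ m_{k+1}). *)

theory Defs
  imports "HOL-Probability.Probability"
begin

section \<open>Extended-real-valued functions on a Euclidean space\<close>

definition edom :: "('d \<Rightarrow> ereal) \<Rightarrow> 'd set" where
  "edom f = {x. f x < \<infinity>}"

definition proper_fun :: "('d \<Rightarrow> ereal) \<Rightarrow> bool" where
  "proper_fun f \<longleftrightarrow> (\<forall>x. f x \<noteq> -\<infinity>) \<and> edom f \<noteq> {}"

definition lsc_fun :: "('d::topological_space \<Rightarrow> ereal) \<Rightarrow> bool" where
  "lsc_fun f \<longleftrightarrow> (\<forall>x. f x \<le> Liminf (at x) f)"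

(* Only meant for functions that never take the value -\<infinity>; then no term
   of the form \<infinity> - \<infinity> occurs on the right-hand side. *)
definition convex_fun :: "('d::real_vector \<Rightarrow> ereal) \<Rightarrow> bool" where
  "convex_fun f \<longleftrightarrow>
     (\<forall>x y. \<forall>u\<ge>0. \<forall>v\<ge>0. u + v = 1 \<longrightarrow>
        f (u *\<^sub>R x + v *\<^sub>R y) \<le> ereal u * f x + ereal v * f y)"

definition strictly_convex_on :: "'d::real_vector set \<Rightarrow> ('d \<Rightarrow> ereal) \<Rightarrow> bool" where
  "strictly_convex_on S f \<longleftrightarrow>
     (\<forall>x\<in>S. \<forall>y\<in>S. \<forall>u>0. \<forall>v>0. x \<noteq> y \<and> u + v = 1 \<longrightarrow>
        f (u *\<^sub>R x + v *\<^sub>R y) < ereal u * f x + ereal v * f y)"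

definition strongly_convex_fun :: "real \<Rightarrow> ('d::euclidean_space \<Rightarrow> ereal) \<Rightarrow> bool" where
  "strongly_convex_fun \<mu> f \<longleftrightarrow> convex_fun (\<lambda>x. f x - ereal (\<mu> / 2 * (norm x)\<^sup>2))"

definition subdifferential :: "('d::euclidean_space \<Rightarrow> ereal) \<Rightarrow> 'd \<Rightarrow> 'd set" where
  "subdifferential f x =
     {g. \<bar>f x\<bar> \<noteq> \<infinity> \<and> (\<forall>y. f x + ereal (g \<bullet> (y - x)) \<le> f y)}"

(* real_of_ereal maps infinite values to 0, so f is required to be finite near x. *)
definition has_gradient :: "('d::euclidean_space \<Rightarrow> ereal) \<Rightarrow> 'd \<Rightarrow> 'd \<Rightarrow> bool" where
  "has_gradient f g x \<longleftrightarrow>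
     x \<in> interior {y. \<bar>f y\<bar> \<noteq> \<infinity>} \<and> GDERIV (\<lambda>y. real_of_ereal (f y)) x :> g"

definition differentiable_pt :: "('d::euclidean_space \<Rightarrow> ereal) \<Rightarrow> 'd \<Rightarrow> bool" where
  "differentiable_pt f x \<longleftrightarrow> (\<exists>g. has_gradient f g x)"

definition gradient :: "('d::euclidean_space \<Rightarrow> ereal) \<Rightarrow> 'd \<Rightarrow> 'd" where
  "gradient f x = (THE g. has_gradient f g x)"

definition C1_fun_on :: "'d::euclidean_space set \<Rightarrow> ('d \<Rightarrow> ereal) \<Rightarrow> bool" where
  "C1_fun_on S f \<longleftrightarrow> (\<forall>x\<in>S. differentiable_pt f x) \<and> continuous_on S (gradient f)"

definition fenchel_conjugate :: "('d::euclidean_space \<Rightarrow> ereal) \<Rightarrow> 'd \<Rightarrow> ereal" where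
  "fenchel_conjugate f p = (SUP x. ereal (p \<bullet> x) - f x)"

section \<open>Kernels, Bregman distance, smooth adaptable functions\<close>

definition kernel_class :: "'d::euclidean_space set \<Rightarrow> ('d \<Rightarrow> ereal) set" where
  "kernel_class C =
     {\<phi>. proper_fun \<phi> \<and> lsc_fun \<phi> \<and> convex_fun \<phi> \<and> edom \<phi> \<subseteq> closure C \<and>
         {x. subdifferential \<phi> x \<noteq> {}} = C \<and> interior (edom \<phi>) = C \<and> C1_fun_on C \<phi>}"

definition legendre_kernel :: "('d::euclidean_space \<Rightarrow> ereal) \<Rightarrow> bool" where
  "legendre_kernel \<phi> \<longleftrightarrow>
     interior (edom \<phi>) \<noteq> {} \<and>
     (\<forall>x\<in>interior (edom \<phi>). differentiable_pt \<phi> x) \<and>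
     strictly_convex_on (interior (edom \<phi>)) \<phi> \<and>
     (\<forall>s x. (\<forall>k::nat. s k \<in> interior (edom \<phi>)) \<and> s \<longlonglongrightarrow> x \<and> x \<in> frontier (edom \<phi>) \<longrightarrow>
        filterlim (\<lambda>k. norm (gradient \<phi> (s k))) at_top sequentially) \<and>
     ((\<lambda>x. \<phi> x / ereal (norm x)) \<longlongrightarrow> \<infinity>) at_infinity"

(* Intended for y in interior (edom \<phi>); the value is \<infinity> for x outside edom \<phi>. *)
definition bregman :: "('d::euclidean_space \<Rightarrow> ereal) \<Rightarrow> 'd \<Rightarrow> 'd \<Rightarrow> ereal" where
  "bregman \<phi> x y = \<phi> x - \<phi> y - ereal (gradient \<phi> y \<bullet> (x - y))"

definition smooth_adaptable ::
    "'d::euclidean_space set \<Rightarrow> real \<Rightarrow> ('d \<Rightarrow> ereal) \<Rightarrow> ('d \<Rightarrow> ereal) \<Rightarrow> bool" where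
  "smooth_adaptable C L \<phi> F \<longleftrightarrow>
     convex_on C (\<lambda>x. L * real_of_ereal (\<phi> x) + real_of_ereal (F x)) \<and>
     convex_on C (\<lambda>x. L * real_of_ereal (\<phi> x) - real_of_ereal (F x))"

section \<open>The stochastic objective and the algorithm\<close>

(* F x is the extended expectation of f x over \<Xi>, i.e. the integral of the
   positive part (possibly \<infinity>) minus that of the negative part (finite). *)
definition expectation_objective ::
    "'d::euclidean_space set \<Rightarrow> 'x measure \<Rightarrow> ('d \<Rightarrow> 'x \<Rightarrow> ereal) \<Rightarrow> ('d \<Rightarrow> ereal) \<Rightarrow> bool" where
  "expectation_objective C \<Xi> f F \<longleftrightarrow>
     prob_space \<Xi> \<and>
     (\<forall>\<xi>\<in>space \<Xi>. proper_fun (\<lambda>x. f x \<xi>) \<and> (\<forall>x\<in>C. differentiable_pt (\<lambda>y. f y \<xi>) x)) \<and>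
     (\<forall>x. f x \<in> borel_measurable \<Xi> \<and>
          (\<integral>\<^sup>+\<xi>. e2ennreal (- f x \<xi>) \<partial>\<Xi>) < \<infinity> \<and>
          F x = enn2ereal (\<integral>\<^sup>+\<xi>. e2ennreal (f x \<xi>) \<partial>\<Xi>)
                - enn2ereal (\<integral>\<^sup>+\<xi>. e2ennreal (- f x \<xi>) \<partial>\<Xi>))"

definition prox ::
    "'d::euclidean_space set \<Rightarrow> ('d \<Rightarrow> ereal) \<Rightarrow> ('d \<Rightarrow> ereal) \<Rightarrow> real \<Rightarrow> 'd \<Rightarrow> 'd" where
  "prox C \<phi> R \<alpha> x = arg_min_on (\<lambda>u. ereal \<alpha> * R u + bregman \<phi> u x) (closure C)"

(* v is the gradient estimator in use at the point x. *)
definition bregman_grad_map ::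
    "'d::euclidean_space set \<Rightarrow> ('d \<Rightarrow> ereal) \<Rightarrow> ('d \<Rightarrow> ereal) \<Rightarrow> real \<Rightarrow> 'd \<Rightarrow> 'd \<Rightarrow> 'd" where
  "bregman_grad_map C \<phi> R \<alpha> v x =
     (1 / \<alpha>) *\<^sub>R
       (x - prox C \<phi> R \<alpha> (gradient (fenchel_conjugate \<phi>) (gradient \<phi> x - \<alpha> *\<^sub>R v)))"

(* X and V are the iterates and the gradient estimators, G the stochastic
   gradients. V 0 = v0 is given, so G 0 is not used by the recursion. *)
definition msbpg ::
    "'d::euclidean_space set \<Rightarrow> ('d \<Rightarrow> ereal) \<Rightarrow> ('d \<Rightarrow> ereal) \<Rightarrow> (nat \<Rightarrow> real) \<Rightarrow> (nat \<Rightarrow> real) \<Rightarrow>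
     'w set \<Rightarrow> (nat \<Rightarrow> 'w \<Rightarrow> 'd) \<Rightarrow> 'd \<Rightarrow> 'd \<Rightarrow> (nat \<Rightarrow> 'w \<Rightarrow> 'd) \<Rightarrow> (nat \<Rightarrow> 'w \<Rightarrow> 'd) \<Rightarrow> bool" where
  "msbpg C \<phi> R \<alpha> \<beta> \<Omega> G x0 v0 X V \<longleftrightarrow>
     (\<forall>\<omega>\<in>\<Omega>. X 0 \<omega> = x0 \<and> V 0 \<omega> = v0 \<and>
       (\<forall>k. V (Suc k) \<omega> = (1 - \<beta> (Suc k)) *\<^sub>R V k \<omega> + \<beta> (Suc k) *\<^sub>R G (Suc k) \<omega>) \<and>
       (\<forall>k. is_arg_min
              (\<lambda>x. R x + ereal (V k \<omega> \<bullet> (x - X k \<omega>)) + ereal (1 / \<alpha> k) * bregman \<phi> x (X k \<omega>))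
              (\<lambda>x. x \<in> closure C) (X (Suc k) \<omega>)))"

(* Vector-valued conditional expectations are taken coordinatewise; the
   integrability conjunct says that they exist. m k is the size of the
   mini-batch behind G k; as G (Suc k) enters V (Suc k) with weight
   \<beta> (Suc k), it is m (Suc k) that goes with the stepsize \<alpha> k
   (a multiple of \<beta> (Suc k)) in error bounds for V (Suc k). *)
definition noise_requirement ::
    "'w measure \<Rightarrow> (nat \<Rightarrow> 'w measure) \<Rightarrow> ('d::euclidean_space \<Rightarrow> ereal) \<Rightarrow>
     (nat \<Rightarrow> 'w \<Rightarrow> 'd) \<Rightarrow> (nat \<Rightarrow> 'w \<Rightarrow> 'd) \<Rightarrow> real \<Rightarrow> (nat \<Rightarrow> nat) \<Rightarrow> bool" where
  "noise_requirement M \<F> F X G \<sigma> m \<longleftrightarrow>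
     (\<forall>k. integrable M (G k) \<and>
       (\<forall>b\<in>Basis. AE \<omega> in M.
          real_cond_exp M (\<F> k) (\<lambda>\<omega>. G k \<omega> \<bullet> b) \<omega> = gradient F (X k \<omega>) \<bullet> b) \<and>
       (AE \<omega> in M.
          nn_cond_exp M (\<F> k) (\<lambda>\<omega>. ennreal ((norm (G k \<omega> - gradient F (X k \<omega>)))\<^sup>2)) \<omega>
            \<le> ennreal (\<sigma>\<^sup>2 / real (m k))))"

end

theory Submission
  imports Defs
begin

text \<open>
  The proof follows the potential \<open>\<Phi> (X k) - \<Phi>* + c \<parallel>V k - \<nabla>F (X k)\<parallel>\<^sup>2\<close>, where \<open>\<nabla>F\<close> is the gradient of
  \<open>F\<close> and \<open>\<Phi>*\<close> the infimum of \<open>\<Phi>\<close>.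

  The Lipschitz-like bound \<open>\<parallel>\<nabla>F y - \<nabla>F x\<parallel>\<^sup>2 \<le> \<kappa> D y x\<close> does two things. By the mean value theorem and the
  strong convexity of the kernel it gives the descent inequality
  \<open>F y \<le> F x + \<nabla>F x \<bullet> (y - x) + sqrt (2 * \<kappa> / \<mu>) * D y x\<close> (\<open>descent\<close>), and it controls how far the
  gradient moves from one iterate to the next. The objective of the proximal step is
  \<open>\<mu> / \<alpha>\<close>-strongly convex, so its minimizer beats the current iterate by a quadratic margin
  (\<open>minimizer_growth\<close>). For \<open>c \<le> 1 / (2 * sqrt (\<mu> * \<kappa>))\<close> these facts combine, for every realization
  of the noise, into

    \<open>\<Phi> z + c (1 - \<beta>)\<^sup>2 \<parallel>v - \<nabla>F z\<parallel>\<^sup>2 + \<mu> / (8 \<alpha>) \<parallel>x - z\<parallel>\<^sup>2 \<le> \<Phi> x + c \<parallel>v - \<nabla>F x\<parallel>\<^sup>2\<close>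

  for a step from \<open>x\<close> to \<open>z\<close> (\<open>potential_decrease\<close>). After subtraction of \<open>\<Phi>*\<close> all terms are
  nonnegative, so the inequality can be integrated without any integrability assumption.

  The factor \<open>(1 - \<beta>)\<^sup>2\<close> is the one that the moving average produces: the next estimation error is
  \<open>(1 - \<beta>) (V k - \<nabla>F (X (k + 1)))\<close> plus \<open>\<beta>\<close> times a noise term of conditional mean zero, and the two are
  orthogonal (\<open>tracking_error\<close>). The sum therefore telescopes (\<open>expected_displacements\<close>), and the
  noise of the estimator formed after the last step never appears. Its absence permits an index
  shift in the batch sizes when they do not decrease.

  Two facts about the kernel connect the algorithm with the gradient mapping. The iterates stay in
  the open set \<open>C\<close> because the gradients of the kernel blow up at its boundary
  (\<open>bounded_slope_imp_interior\<close>), and the gradient of the Fenchel conjugate inverts the gradient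
  of the kernel (\<open>gradient_fenchel_conjugate\<close>), so that the mapping at the \<open>k\<close>-th iterate is
  \<open>(X k - X (k + 1)) / \<alpha> k\<close>. An independent random index finally turns the sum into a
  weighted average (\<open>nn_integral_random_index\<close>).
\<close>

section \<open>Extended-real-valued functions: gradients, semicontinuity, convexity\<close>

lemma has_gradient_unique:
  assumes "has_gradient f g x" "has_gradient f h x"
  shows "g = h"
proof -
  have "(\<lambda>y. y \<bullet> g) = (\<lambda>y. y \<bullet> h)"
    using assms unfolding has_gradient_def gderiv_def by (meson has_derivative_unique)
  then have "y \<bullet> g = y \<bullet> h" for y by meson
  then show ?thesis by (metis inner_commute vector_eq_rdot)
qed

lemma gradient_eqI: "has_gradient f g x \<Longrightarrow> gradient f x = g"
  unfolding gradient_def using has_gradient_unique by (metis the_equality)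

lemma has_gradient_gradient: "differentiable_pt f x \<Longrightarrow> has_gradient f (gradient f x) x"
  unfolding differentiable_pt_def using gradient_eqI by metis

lemma has_gradient_directional:
  assumes "has_gradient f g (x + t *\<^sub>R d)"
  shows "((\<lambda>s. real_of_ereal (f (x + s *\<^sub>R d))) has_real_derivative g \<bullet> d) (at t)"
proof -
  have 1: "((\<lambda>y. real_of_ereal (f y)) has_derivative (\<lambda>h. h \<bullet> g)) (at (x + t *\<^sub>R d))"
    using assms by (simp add: has_gradient_def gderiv_def)
  have 2: "((\<lambda>s::real. x + s *\<^sub>R d) has_derivative (\<lambda>s. s *\<^sub>R d)) (at t)"
    by (auto intro!: derivative_eq_intros)
  show ?thesis
    using has_derivative_compose[OF 2 1] unfolding has_field_derivative_def
    by (rule has_derivative_eq_rhs) (auto simp: inner_commute)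
qed

lemma lsc_fun_eventually_less:
  assumes "lsc_fun f" "d < f x"
  shows "\<forall>\<^sub>F y in nhds x. d < f y"
proof -
  have "d < Liminf (at x) f" using assms unfolding lsc_fun_def by (meson less_le_trans)
  then show ?thesis using assms(2) less_LiminfD eventually_nhds_conv_at by blast
qed

lemma lsc_fun_LIMSEQ_le:
  assumes "lsc_fun f" "s \<longlonglongrightarrow> x" "\<And>n. f (s n) \<le> ereal (a n)" "a \<longlonglongrightarrow> l"
  shows "f x \<le> ereal l"
proof (rule ccontr)
  assume "\<not> ?thesis"
  then obtain d where d: "ereal l < ereal d" "ereal d < f x"
    by (metis ereal_dense2 not_le)
  have "\<forall>\<^sub>F n in sequentially. ereal d < f (s n)"
    using eventually_compose_filterlim[OF lsc_fun_eventually_less[OF assms(1) d(2)] assms(2)] .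
  moreover have "\<forall>\<^sub>F n in sequentially. a n < d"
    using order_tendstoD(2)[OF assms(4)] d(1) by simp
  ultimately have "\<forall>\<^sub>F n in sequentially. False"
    by eventually_elim (use assms(3) in \<open>metis less_ereal.simps(1) not_le order.strict_trans1 order.strict_trans\<close>)
  then show False by simp
qed

lemma lsc_fun_borel_measurable:
  assumes "lsc_fun f"
  shows "f \<in> borel_measurable borel"
proof (rule borel_measurableI_greater)
  fix y
  have "open {x. y < f x}"
  proof (subst open_subopen, intro ballI)
    fix x assume "x \<in> {x. y < f x}"
    then have "\<forall>\<^sub>F z in nhds x. y < f z" using lsc_fun_eventually_less[OF assms] by simp
    then show "\<exists>T. open T \<and> x \<in> T \<and> T \<subseteq> {x. y < f x}" unfolding eventually_nhds by blast
  qed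
  then show "{x \<in> space borel. y < f x} \<in> sets borel" by simp
qed

text \<open>Convexity along the segment from \<open>x\<close> to \<open>y\<close>, for the real-valued restriction to the domain.\<close>
lemma convex_fun_realD:
  assumes "convex_fun f" "\<And>x. f x \<noteq> -\<infinity>" "x \<in> edom f" "y \<in> edom f" "0 \<le> t" "t \<le> 1"
  shows "x + t *\<^sub>R (y - x) \<in> edom f"
    and "real_of_ereal (f (x + t *\<^sub>R (y - x))) \<le> (1 - t) * real_of_ereal (f x) + t * real_of_ereal (f y)"
proof -
  obtain a b where ab: "f x = ereal a" "f y = ereal b"
    using assms(2-4) unfolding edom_def by (metis ereal_cases less_irrefl mem_Collect_eq)
  have eq: "x + t *\<^sub>R (y - x) = (1 - t) *\<^sub>R x + t *\<^sub>R y" by (simp add: algebra_simps)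
  have le: "f (x + t *\<^sub>R (y - x)) \<le> ereal ((1 - t) * a + t * b)"
    using assms(1)[unfolded convex_fun_def, rule_format, of "1 - t" t x y] assms(5,6) ab
    unfolding eq by simp
  then show "x + t *\<^sub>R (y - x) \<in> edom f" unfolding edom_def by (auto intro: le_less_trans)
  show "real_of_ereal (f (x + t *\<^sub>R (y - x))) \<le> (1 - t) * real_of_ereal (f x) + t * real_of_ereal (f y)"
    using le assms(2)[of "x + t *\<^sub>R (y - x)"] ab
    by (cases "f (x + t *\<^sub>R (y - x))") auto
qed

lemma norm_sq_convex_combination:
  fixes x y :: "'a::real_inner"
  shows "(norm (x + t *\<^sub>R (y - x)))\<^sup>2
    = (1 - t) * (norm x)\<^sup>2 + t * (norm y)\<^sup>2 - t * (1 - t) * (norm (y - x))\<^sup>2"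
  unfolding power2_norm_eq_inner
  by (simp add: algebra_simps inner_commute power2_eq_square)

lemma strongly_convex_fun_realD:
  assumes "strongly_convex_fun \<mu> f" "\<And>x. f x \<noteq> -\<infinity>" "x \<in> edom f" "y \<in> edom f" "0 \<le> t" "t \<le> 1"
  shows "x + t *\<^sub>R (y - x) \<in> edom f"
    and "real_of_ereal (f (x + t *\<^sub>R (y - x)))
      \<le> (1 - t) * real_of_ereal (f x) + t * real_of_ereal (f y) - \<mu> / 2 * t * (1 - t) * (norm (y - x))\<^sup>2"
proof -
  define g where "g x = f x - ereal (\<mu> / 2 * (norm x)\<^sup>2)" for x
  have ed: "z \<in> edom g \<longleftrightarrow> z \<in> edom f" and ninf: "g z \<noteq> -\<infinity>" for z
    using assms(2)[of z] unfolding edom_def g_def by (cases "f z"; simp)+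
  have re: "real_of_ereal (g z) = real_of_ereal (f z) - \<mu> / 2 * (norm z)\<^sup>2" if "z \<in> edom f" for z
    using assms(2)[of z] that unfolding edom_def g_def by (cases "f z") auto
  have cv: "convex_fun g" using assms(1) unfolding strongly_convex_fun_def g_def .
  note * = convex_fun_realD[OF cv ninf, of x y t, unfolded ed, OF assms(3-6)]
  show "x + t *\<^sub>R (y - x) \<in> edom f" using *(1) .
  show "real_of_ereal (f (x + t *\<^sub>R (y - x)))
      \<le> (1 - t) * real_of_ereal (f x) + t * real_of_ereal (f y) - \<mu> / 2 * t * (1 - t) * (norm (y - x))\<^sup>2"
    using *(2) unfolding re[OF assms(3)] re[OF assms(4)] re[OF *(1)] norm_sq_convex_combination
    by (simp add: field_simps)
qed

section \<open>Strongly convex Legendre kernels\<close>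

text \<open>A \<open>\<mu>\<close>-strongly convex Legendre kernel on an open convex set. Its values and its Bregman
  distance are handled through the real-valued \<open>ph\<close> and \<open>bd\<close>, which carry their intended meaning
  on the domain of \<open>\<phi>\<close> only.\<close>
locale strong_kernel =
  fixes C :: "'d::euclidean_space set" and \<phi> :: "'d \<Rightarrow> ereal" and \<mu> :: real
  assumes open_C: "open C" and convex_C: "convex C"
    and kernel: "\<phi> \<in> kernel_class C" and legendre: "legendre_kernel \<phi>"
    and mu_pos: "\<mu> > 0" and strongly_convex: "strongly_convex_fun \<mu> \<phi>"
begin

abbreviation ph :: "'d \<Rightarrow> real" where "ph x \<equiv> real_of_ereal (\<phi> x)"

text \<open>The Bregman distance \<open>bregman \<phi> y x\<close> as a real number, for \<open>y\<close> in the domain and \<open>x\<close> in \<open>C\<close>.\<close>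
definition bd :: "'d \<Rightarrow> 'd \<Rightarrow> real" where
  "bd y x = ph y - ph x - gradient \<phi> x \<bullet> (y - x)"

lemma phi_not_MInf: "\<phi> x \<noteq> -\<infinity>"
  using kernel by (auto simp: kernel_class_def proper_fun_def)

lemma ereal_ph: "x \<in> edom \<phi> \<Longrightarrow> \<phi> x = ereal (ph x)"
  using phi_not_MInf[of x] by (cases "\<phi> x") (auto simp: edom_def)

lemma lsc_phi: "lsc_fun \<phi>"
  using kernel by (auto simp: kernel_class_def)

lemma interior_edom: "interior (edom \<phi>) = C"
  using kernel by (auto simp: kernel_class_def)

lemma C_subset_edom: "C \<subseteq> edom \<phi>"
  using interior_edom interior_subset by blast

lemma edom_subset_closure: "edom \<phi> \<subseteq> closure C"
  using kernel by (auto simp: kernel_class_def)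

lemma has_gradient_phi: "x \<in> C \<Longrightarrow> has_gradient \<phi> (gradient \<phi> x) x"
  using kernel by (intro has_gradient_gradient) (simp add: kernel_class_def C1_fun_on_def)

lemmas strong_conv = strongly_convex_fun_realD[OF strongly_convex phi_not_MInf]

lemma bregman_eq:
  assumes "y \<in> edom \<phi>" "x \<in> C"
  shows "bregman \<phi> y x = ereal (bd y x)"
proof -
  have "x \<in> edom \<phi>" using assms C_subset_edom by blast
  then obtain a b where "\<phi> x = ereal a" "\<phi> y = ereal b" using ereal_ph assms(1) by blast
  then show ?thesis unfolding bregman_def bd_def by simp
qed

text \<open>Obtained by letting \<open>t\<close> tend to \<open>0\<close> in the difference quotients of strong convexity.\<close>
lemma bd_lower:
  assumes "x \<in> C" "y \<in> edom \<phi>"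
  shows "\<mu> / 2 * (norm (y - x))\<^sup>2 \<le> bd y x"
proof -
  let ?q = "\<lambda>t. (ph (x + t *\<^sub>R (y - x)) - ph x) / t"
  have x: "x \<in> edom \<phi>" using assms C_subset_edom by blast
  have lim: "(?q \<longlongrightarrow> gradient \<phi> x \<bullet> (y - x)) (at_right 0)"
    using has_gradient_directional[of \<phi> "gradient \<phi> x" x 0 "y - x"] has_gradient_phi[OF assms(1)]
    unfolding has_field_derivative_iff
    by (auto intro: tendsto_within_subset)
  have le: "\<forall>\<^sub>F t in at_right 0. ?q t \<le> ph y - ph x - \<mu> / 2 * (1 - t) * (norm (y - x))\<^sup>2"
    unfolding eventually_at_right_field
  proof (intro exI[of _ 1] conjI allI impI)
    fix t :: real assume t: "0 < t" "t < 1"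
    have "ph (x + t *\<^sub>R (y - x)) - ph x \<le> t * (ph y - ph x - \<mu> / 2 * (1 - t) * (norm (y - x))\<^sup>2)"
      using strong_conv(2)[OF x assms(2), of t] t by (simp add: algebra_simps)
    then show "?q t \<le> ph y - ph x - \<mu> / 2 * (1 - t) * (norm (y - x))\<^sup>2"
      using t by (simp add: pos_divide_le_eq mult.commute)
  qed simp
  have "((\<lambda>t. ph y - ph x - \<mu> / 2 * (1 - t) * (norm (y - x))\<^sup>2) \<longlongrightarrow>
      ph y - ph x - \<mu> / 2 * (1 - 0) * (norm (y - x))\<^sup>2) (at_right 0)"
    by (intro tendsto_intros)
  from tendsto_le[OF _ this lim le] show ?thesis unfolding bd_def by simp
qed

lemma bd_nonneg: "x \<in> C \<Longrightarrow> y \<in> edom \<phi> \<Longrightarrow> 0 \<le> bd y x"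
  using bd_lower[of x y] mu_pos by (smt (verit) mult_nonneg_nonneg zero_le_power2 divide_nonneg_pos)

text \<open>A point of the domain from which the kernel does not descend infinitely steeply towards a
  point \<open>u\<close> of \<open>C\<close> lies in \<open>C\<close>. Otherwise the gradients on the segment would blow up near \<open>z\<close>; but the
  subgradient inequality, tested at \<open>z\<close> and on a ball around \<open>u\<close>, bounds them.\<close>
lemma bounded_slope_imp_interior:
  assumes z: "z \<in> edom \<phi>" and u: "u \<in> C"
    and slope: "\<And>t. 0 < t \<Longrightarrow> t \<le> 1 \<Longrightarrow> ph z - K * t \<le> ph (z + t *\<^sub>R (u - z))"
  shows "z \<in> C"
proof (rule ccontr)
  assume nz: "z \<notin> C"
  define s where "s n = z + (1 / real (Suc n)) *\<^sub>R (u - z)" for n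
  define p where "p n = gradient \<phi> (s n)" for n
  have cvx: "convex (edom \<phi>)"
    unfolding convex_alt
  proof (intro ballI allI impI)
    fix x y :: 'd and t :: real
    assume "x \<in> edom \<phi>" "y \<in> edom \<phi>" "0 \<le> t \<and> t \<le> 1"
    moreover have "(1 - t) *\<^sub>R x + t *\<^sub>R y = x + t *\<^sub>R (y - x)" by (simp add: algebra_simps)
    ultimately show "(1 - t) *\<^sub>R x + t *\<^sub>R y \<in> edom \<phi>" using strong_conv(1)[of x y t] by simp
  qed
  have sC: "s n \<in> C" for n
  proof -
    show ?thesis
      using mem_interior_convex_shrink[OF cvx, of u z "1 / real (Suc n)"] u z
      unfolding interior_edom s_def by (simp add: algebra_simps)
  qed
  have "(\<lambda>n. z + (1 / real (Suc n)) *\<^sub>R (u - z)) \<longlonglongrightarrow> z + 0 *\<^sub>R (u - z)"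
    by (intro tendsto_intros LIMSEQ_Suc[OF lim_1_over_n])
  then have sz: "s \<longlonglongrightarrow> z" unfolding s_def by simp
  have fr: "z \<in> frontier (edom \<phi>)"
    using z nz closure_subset unfolding frontier_def interior_edom by blast
  have top: "filterlim (\<lambda>n. norm (p n)) at_top sequentially"
    using legendre sz fr sC unfolding legendre_kernel_def interior_edom p_def by blast
  obtain \<rho> where \<rho>: "\<rho> > 0" "cball u \<rho> \<subseteq> C"
    using open_contains_cball open_C u by blast
  \<comment> \<open>Testing the gradient at \<open>s n\<close> against \<open>z\<close> bounds its component along \<open>u - z\<close> from below,
      testing it against \<open>u + \<rho> w\<close> then bounds its component along \<open>w\<close> from above.\<close>
  have bnd: "\<rho> * (p n \<bullet> w) \<le> \<bar>ph (u + \<rho> *\<^sub>R w)\<bar> + \<bar>ph z\<bar> + 2 * \<bar>K\<bar>" if w: "norm w = 1" for n w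
  proof -
    define t where "t = 1 / real (Suc n)"
    have t: "0 < t" "t \<le> 1" unfolding t_def by auto
    have sn: "s n = z + t *\<^sub>R (u - z)" unfolding s_def t_def by simp
    have ue: "u + \<rho> *\<^sub>R w \<in> edom \<phi>"
      using \<rho> w C_subset_edom by (auto simp: dist_norm subset_eq)
    have a: "ph (s n) + p n \<bullet> (u + \<rho> *\<^sub>R w - s n) \<le> ph (u + \<rho> *\<^sub>R w)"
      using bd_nonneg[OF sC ue, of n] unfolding bd_def p_def by simp
    have b: "ph (s n) + p n \<bullet> (z - s n) \<le> ph z"
      using bd_nonneg[OF sC z, of n] unfolding bd_def p_def by simp
    have sl: "ph z - K * t \<le> ph (s n)" using slope[OF t] sn by simp
    have zs: "z - s n = - t *\<^sub>R (u - z)" unfolding sn by simp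
    have "t * (- K) \<le> t * (p n \<bullet> (u - z))" using b sl unfolding zs by (simp add: mult.commute)
    then have c: "p n \<bullet> (u - z) \<ge> - K" using t mult_le_cancel_left_pos by blast
    have us: "u + \<rho> *\<^sub>R w - s n = (1 - t) *\<^sub>R (u - z) + \<rho> *\<^sub>R w" unfolding sn by (simp add: algebra_simps)
    have "(1 - t) * (p n \<bullet> (u - z)) \<ge> (1 - t) * (- K)" using c t by (intro mult_left_mono) auto
    moreover have "(1 - t) * K \<le> \<bar>K\<bar>" "K * t \<le> \<bar>K\<bar>"
      using t mult_mono[of "1 - t" 1 "\<bar>K\<bar>" "\<bar>K\<bar>"] mult_mono[of t 1 "\<bar>K\<bar>" "\<bar>K\<bar>"]
      by (smt (verit) abs_ge_self mult_left_mono mult_right_mono mult.commute)+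
    ultimately show ?thesis
      using a sl abs_ge_self[of "ph (u + \<rho> *\<^sub>R w)"] abs_ge_minus_self[of "ph z"]
      unfolding us inner_right_distrib inner_scaleR_right by linarith
  qed
  define B where "B = (\<Sum>b\<in>Basis. (\<bar>ph (u + \<rho> *\<^sub>R b)\<bar> + \<bar>ph (u + \<rho> *\<^sub>R (- b))\<bar> + \<bar>ph z\<bar> + 2 * \<bar>K\<bar>) / \<rho>)"
  have "norm (p n) \<le> B" for n
  proof -
    have "norm (p n) \<le> (\<Sum>b\<in>Basis. \<bar>p n \<bullet> b\<bar>)" by (rule norm_le_l1)
    also have "\<dots> \<le> B" unfolding B_def
    proof (rule sum_mono)
      fix b :: 'd assume b: "b \<in> Basis"
      show "\<bar>p n \<bullet> b\<bar> \<le> (\<bar>ph (u + \<rho> *\<^sub>R b)\<bar> + \<bar>ph (u + \<rho> *\<^sub>R (- b))\<bar> + \<bar>ph z\<bar> + 2 * \<bar>K\<bar>) / \<rho>"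
        using bnd[of b n] bnd[of "- b" n] b \<rho>(1) unfolding pos_le_divide_eq[OF \<rho>(1)]
        by (auto simp: abs_if mult.commute)
    qed
    finally show ?thesis .
  qed
  moreover have "\<forall>\<^sub>F n in sequentially. B + 1 \<le> norm (p n)"
    using top unfolding filterlim_at_top by blast
  then obtain n where "B + 1 \<le> norm (p n)" using eventually_happens by fastforce
  ultimately show False by (smt (verit))
qed

text \<open>Subgradients exist only at points of \<open>C\<close>, where the gradient is the only one.\<close>
lemma supporting_imp_gradient:
  assumes z: "z \<in> edom \<phi>" and min: "\<And>y. y \<in> edom \<phi> \<Longrightarrow> ph z + p \<bullet> (y - z) \<le> ph y"
  shows "z \<in> C" "gradient \<phi> z = p"
proof -
  have "p \<in> subdifferential \<phi> z"
    unfolding subdifferential_def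
  proof (intro CollectI conjI allI)
    obtain a where a: "\<phi> z = ereal a" using ereal_ph[OF z] by blast
    show "\<bar>\<phi> z\<bar> \<noteq> \<infinity>" unfolding a by simp
    fix y
    show "\<phi> z + ereal (p \<bullet> (y - z)) \<le> \<phi> y"
    proof (cases "y \<in> edom \<phi>")
      case True
      then obtain b where "\<phi> y = ereal b" using ereal_ph by blast
      then show ?thesis using min[OF True] a by simp
    next
      case False
      then show ?thesis unfolding edom_def by simp
    qed
  qed
  then show zC: "z \<in> C" using kernel by (auto simp: kernel_class_def)
  have d: "((\<lambda>y. ph y - p \<bullet> y) has_derivative (\<lambda>h. h \<bullet> gradient \<phi> z - p \<bullet> h)) (at z)"
    using has_gradient_phi[OF zC] unfolding has_gradient_def gderiv_def
    by (auto intro!: derivative_eq_intros)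
  have "(\<lambda>h. h \<bullet> gradient \<phi> z - p \<bullet> h) = (\<lambda>h. 0)"
  proof (rule differential_zero_maxmin[OF zC open_C d])
    show "(\<forall>y\<in>C. ph y - p \<bullet> y \<le> ph z - p \<bullet> z) \<or> (\<forall>y\<in>C. ph z - p \<bullet> z \<le> ph y - p \<bullet> y)"
      using min C_subset_edom by (fastforce simp: inner_diff_right)
  qed
  then have "h \<bullet> gradient \<phi> z = h \<bullet> p" for h
    by (metis inner_commute right_minus_eq)
  then show "gradient \<phi> z = p" by (metis inner_commute vector_eq_rdot)
qed

text \<open>The maximum defining the Fenchel conjugate at \<open>p\<close> is attained, by coercivity and lower
  semicontinuity; the maximizer has gradient \<open>p\<close>.\<close>
lemma gradient_phi_surj:
  obtains z where "z \<in> C" "gradient \<phi> z = p"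
proof -
  obtain x0 where x0: "x0 \<in> C"
    using legendre unfolding legendre_kernel_def interior_edom by blast
  define h where "h x = ph x - p \<bullet> x" for x
  \<comment> \<open>Superlinear growth makes \<open>h\<close> exceed \<open>A\<close>, hence \<open>h x0\<close>, outside a ball, which confines a
      minimizing sequence.\<close>
  define A where "A = \<bar>h x0\<bar> + norm x0 + 1"
  have "((\<lambda>x. \<phi> x / ereal (norm x)) \<longlongrightarrow> \<infinity>) at_infinity"
    using legendre unfolding legendre_kernel_def by blast
  then have "\<forall>\<^sub>F x in at_infinity. ereal (norm p + 1) < \<phi> x / ereal (norm x)"
    unfolding tendsto_PInfty by blast
  then obtain b where b: "\<And>x. b \<le> norm x \<Longrightarrow> ereal (norm p + 1) < \<phi> x / ereal (norm x)"
    unfolding eventually_at_infinity by blast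
  define r where "r = max b A"
  have big: "A \<le> h x" if x: "x \<in> edom \<phi>" "r \<le> norm x" for x
  proof -
    have n: "norm x \<ge> A" "b \<le> norm x" using x unfolding r_def by auto
    have n0: "norm x > 0" using n(1) unfolding A_def by (smt (verit) norm_ge_zero)
    obtain a where a: "\<phi> x = ereal a" using ereal_ph[OF x(1)] by blast
    have "norm p + 1 < a / norm x" using b[OF n(2)] n0 unfolding a by simp
    then have "(norm p + 1) * norm x \<le> a" using n0 by (simp add: pos_less_divide_eq)
    moreover have "p \<bullet> x \<le> norm p * norm x" by (rule norm_cauchy_schwarz)
    ultimately show ?thesis using n(1) unfolding h_def a by (simp add: algebra_simps)
  qed
  define S where "S = edom \<phi> \<inter> cball 0 r"
  have x0S: "x0 \<in> S" using x0 C_subset_edom unfolding S_def r_def A_def by auto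
  have lower: "\<exists>m. \<forall>x\<in>edom \<phi>. m \<le> h x"
  proof -
    have "h x \<ge> h x0 + (gradient \<phi> x0 - p) \<bullet> (x - x0)" if "x \<in> edom \<phi>" for x
      using bd_nonneg[OF x0 that] unfolding bd_def h_def by (simp add: algebra_simps)
    moreover have "(gradient \<phi> x0 - p) \<bullet> (x - x0) \<ge> - (norm (gradient \<phi> x0 - p) * (r + norm x0))"
      if "norm x \<le> r" for x
    proof -
      have "\<bar>(gradient \<phi> x0 - p) \<bullet> (x - x0)\<bar> \<le> norm (gradient \<phi> x0 - p) * norm (x - x0)"
        by (rule Cauchy_Schwarz_ineq2)
      also have "\<dots> \<le> norm (gradient \<phi> x0 - p) * (r + norm x0)"
        using that norm_triangle_ineq4[of x x0] by (intro mult_left_mono) auto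
      finally show ?thesis by linarith
    qed
    ultimately have "min A (h x0 - norm (gradient \<phi> x0 - p) * (r + norm x0)) \<le> h x" if "x \<in> edom \<phi>" for x
      using big[OF that] that by (smt (verit))
    then show ?thesis by blast
  qed
  define m where "m = (INF x\<in>edom \<phi>. h x)"
  have bb: "bdd_below (h ` edom \<phi>)" using lower by (auto simp: bdd_below_def)
  have mle: "m \<le> h x" if "x \<in> edom \<phi>" for x unfolding m_def using bb that by (rule cINF_lower)
  have x0e: "x0 \<in> edom \<phi>" using x0 C_subset_edom by blast
  have "\<exists>x\<in>S. h x < m + 1 / real (Suc n)" for n
  proof (cases "h x0 < m + 1 / real (Suc n)")
    case True
    then show ?thesis using x0S by blast
  next
    case False
    have "(INF x\<in>edom \<phi>. h x) < m + 1 / real (Suc n)" unfolding m_def by simp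
    then obtain x where x: "x \<in> edom \<phi>" "h x < m + 1 / real (Suc n)"
      using cINF_less_iff[OF _ bb] x0e by blast
    then have "h x < h x0" using False by simp
    then have "norm x < r" using big[OF x(1)] unfolding A_def by (smt (verit) norm_ge_zero)
    then show ?thesis using x unfolding S_def by auto
  qed
  then obtain s where s: "\<And>n. s n \<in> S" "\<And>n. h (s n) < m + 1 / real (Suc n)" by metis
  obtain z k where z: "strict_mono k" "(s \<circ> k) \<longlonglongrightarrow> z"
    using s(1) compact_cball[of 0 r] unfolding compact_def S_def by (metis IntD2)
  have le: "\<phi> ((s \<circ> k) n) \<le> ereal (m + 1 / real (Suc (k n)) + p \<bullet> s (k n))" for n
  proof -
    have "s (k n) \<in> edom \<phi>" using s(1) unfolding S_def by blast
    then obtain a where "\<phi> (s (k n)) = ereal a" using ereal_ph by blast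
    then show ?thesis using s(2)[of "k n"] unfolding h_def by simp
  qed
  have "(\<lambda>n. m + 1 / real (Suc (k n)) + p \<bullet> (s \<circ> k) n) \<longlonglongrightarrow> m + 0 + p \<bullet> z"
    using LIMSEQ_subseq_LIMSEQ[OF LIMSEQ_Suc[OF lim_1_over_n] z(1)] unfolding o_def
    by (intro tendsto_intros z(2)[unfolded o_def])
  then have phz: "\<phi> z \<le> ereal (m + p \<bullet> z)"
    using lsc_fun_LIMSEQ_le[OF lsc_phi z(2) le] by simp
  then have ze: "z \<in> edom \<phi>" unfolding edom_def by (auto intro: le_less_trans)
  then obtain a where "\<phi> z = ereal a" using ereal_ph by blast
  then have hz: "h z \<le> m" using phz unfolding h_def by simp
  have "ph z + p \<bullet> (y - z) \<le> ph y" if "y \<in> edom \<phi>" for y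
    using hz mle[OF that] unfolding h_def by (simp add: inner_diff_right)
  from supporting_imp_gradient[OF ze this] show ?thesis using that by blast
qed

lemma fenchel_conjugate_gradient:
  assumes "z \<in> C"
  shows "fenchel_conjugate \<phi> (gradient \<phi> z) = ereal (gradient \<phi> z \<bullet> z - ph z)"
  unfolding fenchel_conjugate_def
proof (rule antisym)
  have ze: "z \<in> edom \<phi>" using assms C_subset_edom by blast
  show "(SUP x. ereal (gradient \<phi> z \<bullet> x) - \<phi> x) \<le> ereal (gradient \<phi> z \<bullet> z - ph z)"
  proof (rule SUP_least)
    fix x
    show "ereal (gradient \<phi> z \<bullet> x) - \<phi> x \<le> ereal (gradient \<phi> z \<bullet> z - ph z)"
    proof (cases "x \<in> edom \<phi>")
      case True
      then obtain a where "\<phi> x = ereal a" using ereal_ph by blast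
      then show ?thesis
        using bd_nonneg[OF assms True] unfolding bd_def by (simp add: inner_diff_right)
    qed (simp add: edom_def)
  qed
  obtain a where "\<phi> z = ereal a" using ereal_ph[OF ze] by blast
  then have "ereal (gradient \<phi> z \<bullet> z) - \<phi> z = ereal (gradient \<phi> z \<bullet> z - ph z)" by simp
  then show "ereal (gradient \<phi> z \<bullet> z - ph z) \<le> (SUP x. ereal (gradient \<phi> z \<bullet> x) - \<phi> x)"
    using SUP_upper[of z UNIV "\<lambda>x. ereal (gradient \<phi> z \<bullet> x) - \<phi> x"] by simp
qed

text \<open>Strong convexity makes the maximizers depend on the slope in a \<open>1 / \<mu>\<close>-Lipschitz way, so the
  remainder of the first-order expansion of the conjugate is quadratic.\<close>
lemma gradient_fenchel_conjugate:
  assumes z: "z \<in> C"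
  shows "gradient (fenchel_conjugate \<phi>) (gradient \<phi> z) = z"
proof (rule gradient_eqI)
  let ?p = "gradient \<phi> z"
  let ?f = "\<lambda>q. real_of_ereal (fenchel_conjugate \<phi> q)"
  have fin: "\<bar>fenchel_conjugate \<phi> q\<bar> \<noteq> \<infinity>" for q
  proof -
    obtain w where w: "w \<in> C" "gradient \<phi> w = q" using gradient_phi_surj .
    then show ?thesis using fenchel_conjugate_gradient[OF w(1)] by simp
  qed
  have bnd: "norm (?f q - ?f ?p - (q - ?p) \<bullet> z) \<le> (norm (q - ?p))\<^sup>2 / \<mu>" for q
  proof -
    obtain w where w: "w \<in> C" "gradient \<phi> w = q" using gradient_phi_surj .
    have ze: "z \<in> edom \<phi>" "w \<in> edom \<phi>" using z w C_subset_edom by auto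
    have f: "?f q = q \<bullet> w - ph w" "?f ?p = ?p \<bullet> z - ph z"
      using fenchel_conjugate_gradient[OF w(1)] fenchel_conjugate_gradient[OF z] w(2) by auto
    have a: "\<mu> / 2 * (norm (w - z))\<^sup>2 \<le> ph w - ph z - ?p \<bullet> (w - z)"
      using bd_lower[OF z ze(2)] unfolding bd_def .
    have b: "\<mu> / 2 * (norm (w - z))\<^sup>2 \<le> ph z - ph w - q \<bullet> (z - w)"
      using bd_lower[OF w(1) ze(1)] unfolding bd_def w(2) norm_minus_commute[of z w] .
    have cs: "(q - ?p) \<bullet> (w - z) \<le> norm (q - ?p) * norm (w - z)" by (rule norm_cauchy_schwarz)
    have nn: "0 \<le> \<mu> / 2 * (norm (w - z))\<^sup>2" using mu_pos by simp
    have e1: "0 \<le> ?f q - ?f ?p - (q - ?p) \<bullet> z"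
      using b nn unfolding f by (simp add: algebra_simps)
    have e2: "?f q - ?f ?p - (q - ?p) \<bullet> z \<le> (q - ?p) \<bullet> (w - z)"
      using a nn unfolding f by (simp add: algebra_simps)
    have "\<mu> * (norm (w - z))\<^sup>2 \<le> (q - ?p) \<bullet> (w - z)" using a b by (simp add: algebra_simps)
    then have "norm (w - z) * (\<mu> * norm (w - z)) \<le> norm (w - z) * norm (q - ?p)"
      using cs by (simp add: power2_eq_square algebra_simps)
    then have "\<mu> * norm (w - z) \<le> norm (q - ?p)"
      using mult_le_cancel_left_pos by (cases "norm (w - z) = 0") auto
    then have "norm (w - z) \<le> norm (q - ?p) / \<mu>" using mu_pos by (simp add: pos_le_divide_eq mult.commute)
    then have "norm (q - ?p) * norm (w - z) \<le> norm (q - ?p) * (norm (q - ?p) / \<mu>)"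
      by (intro mult_left_mono) auto
    then show ?thesis using e1 e2 cs by (simp add: power2_eq_square)
  qed
  have "(?f has_derivative (\<lambda>h. h \<bullet> z)) (at ?p)"
    unfolding has_derivative_at_alt
  proof (intro conjI allI impI)
    show "bounded_linear (\<lambda>h. h \<bullet> z)" by (rule bounded_linear_inner_left)
    fix e :: real assume e: "0 < e"
    show "\<exists>d>0. \<forall>y. norm (y - ?p) < d \<longrightarrow> norm (?f y - ?f ?p - (y - ?p) \<bullet> z) \<le> e * norm (y - ?p)"
    proof (intro exI[of _ "e * \<mu>"] conjI allI impI)
      fix y assume y: "norm (y - ?p) < e * \<mu>"
      have "(norm (y - ?p))\<^sup>2 / \<mu> = norm (y - ?p) / \<mu> * norm (y - ?p)" by (simp add: power2_eq_square)
      also have "\<dots> \<le> e * norm (y - ?p)"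
        using y mu_pos by (intro mult_right_mono) (auto simp: pos_divide_le_eq)
      finally show "norm (?f y - ?f ?p - (y - ?p) \<bullet> z) \<le> e * norm (y - ?p)"
        using bnd[of y] by linarith
    qed (use e mu_pos in simp)
  qed
  then show "has_gradient (fenchel_conjugate \<phi>) z ?p"
    unfolding has_gradient_def gderiv_def using fin by simp
qed

end

section \<open>The Bregman proximal step\<close>

text \<open>The data of one proximal step: the current point \<open>x\<close>, the gradient estimator \<open>v\<close> and the
  stepsize \<open>\<alpha>\<close>.\<close>
locale prox_step = strong_kernel C \<phi> \<mu>
  for C :: "'d::euclidean_space set" and \<phi> \<mu> +
  fixes R :: "'d \<Rightarrow> ereal" and \<alpha> :: real and x v :: 'd
  assumes R_not_MInf: "\<And>y. R y \<noteq> -\<infinity>" and convex_R: "convex_fun R"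
    and R_feasible: "edom R \<inter> C \<noteq> {}"
    and alpha_pos: "\<alpha> > 0" and x_in_C: "x \<in> C"
begin

abbreviation rR :: "'d \<Rightarrow> real" where "rR y \<equiv> real_of_ereal (R y)"

text \<open>The function that the step minimizes.\<close>
definition obj :: "'d \<Rightarrow> ereal" where
  "obj u = R u + ereal (v \<bullet> (u - x)) + ereal (1 / \<alpha>) * bregman \<phi> u x"

text \<open>The values of \<open>obj\<close> as real numbers, meaningful where both \<open>R\<close> and \<open>\<phi>\<close> are finite.\<close>
definition robj :: "'d \<Rightarrow> real" where
  "robj u = rR u + v \<bullet> (u - x) + bd u x / \<alpha>"

lemma ereal_R: "y \<in> edom R \<Longrightarrow> R y = ereal (rR y)"
  using R_not_MInf[of y] by (cases "R y") (auto simp: edom_def)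

lemma obj_eq:
  assumes "u \<in> edom R" "u \<in> edom \<phi>"
  shows "obj u = ereal (robj u)"
proof -
  obtain a where "R u = ereal a" using ereal_R assms by blast
  then show ?thesis unfolding obj_def robj_def bregman_eq[OF assms(2) x_in_C] by simp
qed

lemma obj_infinite:
  assumes "u \<notin> edom R \<inter> edom \<phi>"
  shows "obj u = \<infinity>"
proof -
  obtain a where a: "\<phi> x = ereal a" using ereal_ph x_in_C C_subset_edom by blast
  show ?thesis
  proof (cases "u \<in> edom \<phi>")
    case True
    then have "R u = \<infinity>" using assms by (simp add: edom_def)
    then show ?thesis unfolding obj_def bregman_eq[OF True x_in_C] by simp
  next
    case False
    then have "bregman \<phi> u x = \<infinity>" unfolding bregman_def a by (simp add: edom_def)
    then show ?thesis using R_not_MInf[of u] alpha_pos unfolding obj_def by (cases "R u") auto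
  qed
qed

lemma minimizer_iff:
  "is_arg_min obj (\<lambda>u. u \<in> closure C) z \<longleftrightarrow>
    z \<in> edom R \<inter> edom \<phi> \<and> (\<forall>u \<in> edom R \<inter> edom \<phi>. robj z \<le> robj u)"
    (is "?L \<longleftrightarrow> ?Q")
proof
  assume L: ?L
  obtain u0 where u0: "u0 \<in> edom R" "u0 \<in> edom \<phi>" using R_feasible C_subset_edom by blast
  have le: "obj z \<le> obj u" if "u \<in> edom \<phi>" for u
    using L that edom_subset_closure unfolding is_arg_min_def by (meson not_le subsetD)
  have z: "z \<in> edom R \<inter> edom \<phi>"
    using le[OF u0(2)] obj_infinite[of z] obj_eq[OF u0] by fastforce
  then show ?Q using le obj_eq by fastforce
next
  assume Q: ?Q
  have "obj z \<le> obj u" for u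
    using Q obj_infinite[of u] obj_eq[of u] obj_eq[of z] by (cases "u \<in> edom R \<inter> edom \<phi>") auto
  then show ?L using Q edom_subset_closure unfolding is_arg_min_def by (auto simp: not_less)
qed

lemma robj_strongly_convex:
  assumes "y \<in> edom R \<inter> edom \<phi>" "z \<in> edom R \<inter> edom \<phi>" "0 \<le> t" "t \<le> 1"
  shows "y + t *\<^sub>R (z - y) \<in> edom R \<inter> edom \<phi>"
    and "robj (y + t *\<^sub>R (z - y)) \<le> (1 - t) * robj y + t * robj z - \<mu> / (2 * \<alpha>) * t * (1 - t) * (norm (z - y))\<^sup>2"
proof -
  let ?w = "y + t *\<^sub>R (z - y)"
  note r = convex_fun_realD[OF convex_R R_not_MInf, of y z t]
  note p = strong_conv[of y z t]
  show "?w \<in> edom R \<inter> edom \<phi>" using r(1) p(1) assms by blast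
  have "bd ?w x = ph ?w - ((1 - t) * ph y + t * ph z) + ((1 - t) * bd y x + t * bd z x)"
    unfolding bd_def by (simp add: algebra_simps)
  then have "bd ?w x \<le> (1 - t) * bd y x + t * bd z x - \<mu> / 2 * t * (1 - t) * (norm (z - y))\<^sup>2"
    using p(2) assms by auto
  then have "bd ?w x / \<alpha> \<le> ((1 - t) * bd y x + t * bd z x - \<mu> / 2 * t * (1 - t) * (norm (z - y))\<^sup>2) / \<alpha>"
    using alpha_pos by (simp add: divide_right_mono)
  also have "\<dots> = (1 - t) * (bd y x / \<alpha>) + t * (bd z x / \<alpha>) - \<mu> / (2 * \<alpha>) * t * (1 - t) * (norm (z - y))\<^sup>2"
    by (simp add: diff_divide_distrib add_divide_distrib)
  finally have 1: "bd ?w x / \<alpha> \<le> \<dots>" .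
  have 2: "v \<bullet> (?w - x) = (1 - t) * (v \<bullet> (y - x)) + t * (v \<bullet> (z - x))"
    by (simp add: algebra_simps)
  have 3: "rR ?w \<le> (1 - t) * rR y + t * rR z" using r(2) assms by auto
  show "robj ?w \<le> (1 - t) * robj y + t * robj z - \<mu> / (2 * \<alpha>) * t * (1 - t) * (norm (z - y))\<^sup>2"
    using 1 3 unfolding robj_def 2 distrib_left by linarith
qed

lemma minimizer_growth:
  assumes min: "is_arg_min obj (\<lambda>u. u \<in> closure C) z" and u: "u \<in> edom R \<inter> edom \<phi>"
  shows "robj z + \<mu> / (2 * \<alpha>) * (norm (u - z))\<^sup>2 \<le> robj u"
proof -
  have z: "z \<in> edom R \<inter> edom \<phi>" and le: "\<And>u. u \<in> edom R \<inter> edom \<phi> \<Longrightarrow> robj z \<le> robj u"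
    using min unfolding minimizer_iff by auto
  have "robj z + \<mu> / (2 * \<alpha>) * (1 - t) * (norm (u - z))\<^sup>2 \<le> robj u" if t: "0 < t" "t < 1" for t
  proof -
    have "robj z \<le> (1 - t) * robj z + t * robj u - \<mu> / (2 * \<alpha>) * t * (1 - t) * (norm (u - z))\<^sup>2"
      using le[OF robj_strongly_convex(1)[OF z u, of t]] robj_strongly_convex(2)[OF z u, of t] t by simp
    then have "t * (robj z + \<mu> / (2 * \<alpha>) * (1 - t) * (norm (u - z))\<^sup>2) \<le> t * robj u"
      by (simp add: algebra_simps)
    then show ?thesis using t(1) mult_le_cancel_left_pos by blast
  qed
  then have ev: "\<forall>\<^sub>F t in at_right 0. robj z + \<mu> / (2 * \<alpha>) * (1 - t) * (norm (u - z))\<^sup>2 \<le> robj u"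
    unfolding eventually_at_right_field by (intro exI[of _ 1]) auto
  have "((\<lambda>t. robj z + \<mu> / (2 * \<alpha>) * (1 - t) * (norm (u - z))\<^sup>2) \<longlongrightarrow>
      robj z + \<mu> / (2 * \<alpha>) * (1 - 0) * (norm (u - z))\<^sup>2) (at_right 0)"
    by (intro tendsto_intros)
  from tendsto_upperbound[OF this ev] show ?thesis by simp
qed

lemma minimizer_unique:
  assumes "is_arg_min obj (\<lambda>u. u \<in> closure C) z" "is_arg_min obj (\<lambda>u. u \<in> closure C) w"
  shows "w = z"
proof -
  have w: "w \<in> edom R \<inter> edom \<phi>" "robj w \<le> robj z" using assms unfolding minimizer_iff by auto
  have "\<mu> / (2 * \<alpha>) * (norm (w - z))\<^sup>2 \<le> 0" using minimizer_growth[OF assms(1) w(1)] w(2) by simp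
  moreover have "\<mu> / (2 * \<alpha>) > 0" using mu_pos alpha_pos by simp
  ultimately have "(norm (w - z))\<^sup>2 \<le> 0" by (metis mult_le_cancel_left_pos mult_zero_right)
  then show ?thesis by simp
qed

text \<open>Minimality bounds the slope of the kernel at the minimizer towards a feasible point of \<open>C\<close>.\<close>
lemma minimizer_in_C:
  assumes "is_arg_min obj (\<lambda>u. u \<in> closure C) z"
  shows "z \<in> C"
proof -
  have z: "z \<in> edom R \<inter> edom \<phi>" and le: "\<And>u. u \<in> edom R \<inter> edom \<phi> \<Longrightarrow> robj z \<le> robj u"
    using assms unfolding minimizer_iff by auto
  obtain u where u: "u \<in> edom R" "u \<in> C" using R_feasible by blast
  have ue: "u \<in> edom \<phi>" using u C_subset_edom by blast
  define K where "K = \<alpha> * (rR u - rR z + v \<bullet> (u - z)) - gradient \<phi> x \<bullet> (u - z)"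
  show ?thesis
  proof (rule bounded_slope_imp_interior[of z u K])
    fix t :: real assume t: "0 < t" "t \<le> 1"
    let ?w = "z + t *\<^sub>R (u - z)"
    have w: "?w \<in> edom R \<inter> edom \<phi>"
      using robj_strongly_convex(1)[OF z, of u t] u ue t by auto
    have "rR ?w \<le> (1 - t) * rR z + t * rR u"
      using convex_fun_realD(2)[OF convex_R R_not_MInf, of z u t] z u t by auto
    moreover have "robj z \<le> robj ?w" using le[OF w] .
    moreover have "v \<bullet> (?w - x) = v \<bullet> (z - x) + t * (v \<bullet> (u - z))" by (simp add: algebra_simps)
    ultimately have "bd z x / \<alpha> \<le> bd ?w x / \<alpha> + t * (rR u - rR z + v \<bullet> (u - z))"
      unfolding robj_def by (simp add: algebra_simps)
    then have "\<alpha> * (bd z x / \<alpha>) \<le> \<alpha> * (bd ?w x / \<alpha> + t * (rR u - rR z + v \<bullet> (u - z)))"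
      using alpha_pos by (intro mult_left_mono) auto
    then have "bd z x \<le> bd ?w x + t * (\<alpha> * (rR u - rR z + v \<bullet> (u - z)))"
      using alpha_pos by (simp add: algebra_simps)
    then show "ph z - K * t \<le> ph ?w"
      unfolding bd_def K_def by (simp add: algebra_simps)
  qed (use z u in auto)
qed

text \<open>The step of the algorithm is the Bregman proximal map at the mirror point \<open>y\<close> defined by
  \<open>\<nabla>\<phi> y = \<nabla>\<phi> x - \<alpha> v\<close>: the two objectives differ by the positive factor \<open>\<alpha>\<close> and an additive
  constant, the value of \<open>bd x y\<close>. Uniqueness of the minimizer matters, because \<open>prox\<close> chooses one.\<close>
lemma prox_eq_minimizer:
  assumes min: "is_arg_min obj (\<lambda>u. u \<in> closure C) z"
  shows "prox C \<phi> R \<alpha> (gradient (fenchel_conjugate \<phi>) (gradient \<phi> x - \<alpha> *\<^sub>R v)) = z"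
proof -
  obtain y where y: "y \<in> C" "gradient \<phi> y = gradient \<phi> x - \<alpha> *\<^sub>R v" using gradient_phi_surj .
  have gy: "gradient (fenchel_conjugate \<phi>) (gradient \<phi> x - \<alpha> *\<^sub>R v) = y"
    using gradient_fenchel_conjugate[OF y(1)] y(2) by simp
  define g where "g u = ereal \<alpha> * R u + bregman \<phi> u y" for u
  define k where "k = bd x y"
  have gfin: "g u = ereal (\<alpha> * robj u + k)" if u: "u \<in> edom R \<inter> edom \<phi>" for u
  proof -
    obtain a where a: "R u = ereal a" using ereal_R u by blast
    have "\<alpha> * robj u = \<alpha> * a + \<alpha> * (v \<bullet> (u - x)) + bd u x"
      using alpha_pos unfolding robj_def a by (simp add: distrib_left)
    then have "\<alpha> * robj u + k = \<alpha> * a + bd u y"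
      unfolding k_def bd_def y(2) by (simp add: algebra_simps)
    then show ?thesis using u bregman_eq[OF _ y(1), of u] a unfolding g_def by simp
  qed
  have ginf: "g u = \<infinity>" if u: "u \<notin> edom R \<inter> edom \<phi>" for u
  proof (cases "u \<in> edom \<phi>")
    case True
    then have "R u = \<infinity>" using u by (simp add: edom_def)
    then show ?thesis using alpha_pos bregman_eq[OF True y(1)] unfolding g_def by simp
  next
    case False
    obtain a where a: "\<phi> y = ereal a" using ereal_ph y(1) C_subset_edom by blast
    have "bregman \<phi> u y = \<infinity>" using False unfolding bregman_def a by (simp add: edom_def)
    then show ?thesis using R_not_MInf[of u] alpha_pos unfolding g_def by (cases "R u") auto
  qed
  have lt: "g u < g w \<longleftrightarrow> obj u < obj w" for u w
    using gfin[of u] gfin[of w] ginf[of u] ginf[of w] obj_eq[of u] obj_eq[of w]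
      obj_infinite[of u] obj_infinite[of w] alpha_pos
    by (cases "u \<in> edom R \<inter> edom \<phi>"; cases "w \<in> edom R \<inter> edom \<phi>") simp_all
  have "is_arg_min g (\<lambda>u. u \<in> closure C) w \<longleftrightarrow> w = z" for w
    using min minimizer_unique unfolding is_arg_min_def lt by blast
  then have "is_arg_min g (\<lambda>u. u \<in> closure C) = (\<lambda>w. w = z)" by blast
  then have "arg_min g (\<lambda>u. u \<in> closure C) = z" unfolding arg_min_def by simp
  then show ?thesis unfolding prox_def gy arg_min_on_def g_def .
qed

end

section \<open>Decrease of the potential in one step\<close>

text \<open>A kernel together with a function whose gradient differences are controlled by the Bregman
  distance.\<close>
locale bregman_lipschitz_gradient = strong_kernel C \<phi> \<mu>
  for C :: "'d::euclidean_space set" and \<phi> \<mu> +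
  fixes F :: "'d \<Rightarrow> ereal" and \<kappa> :: real
  assumes has_gradient_F: "y \<in> C \<Longrightarrow> has_gradient F (gradient F y) y"
    and kappa_pos: "\<kappa> > 0"
    and gradient_F_bound: "y \<in> C \<Longrightarrow> x \<in> C \<Longrightarrow> (norm (gradient F y - gradient F x))\<^sup>2 \<le> \<kappa> * bd y x"
begin

abbreviation rF :: "'d \<Rightarrow> real" where "rF y \<equiv> real_of_ereal (F y)"

text \<open>The constant \<open>sqrt (2 * \<kappa> / \<mu>)\<close> arises from \<open>\<parallel>\<nabla>F w - \<nabla>F x\<parallel> \<le> sqrt (\<kappa> D)\<close> at an
  intermediate point \<open>w\<close> and \<open>\<parallel>y - x\<parallel> \<le> sqrt (2 D / \<mu>)\<close>, with \<open>D\<close> the distance \<open>bd y x\<close>.\<close>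
lemma descent:
  assumes x: "x \<in> C" and y: "y \<in> C"
  shows "rF y \<le> rF x + gradient F x \<bullet> (y - x) + sqrt (2 * \<kappa> / \<mu>) * bd y x"
proof -
  have e: "x \<in> edom \<phi>" "y \<in> edom \<phi>" using x y C_subset_edom by auto
  let ?w = "\<lambda>t. x + t *\<^sub>R (y - x)"
  have w: "?w t \<in> C" if "0 \<le> t" "t \<le> 1" for t
  proof -
    have "?w t = (1 - t) *\<^sub>R x + t *\<^sub>R y" by (simp add: algebra_simps)
    then show ?thesis using convex_C x y that by (simp add: convex_alt)
  qed
  have der: "((\<lambda>s. rF (?w s)) has_derivative (*) (gradient F (?w t) \<bullet> (y - x))) (at t within {0..1})"
    if "0 \<le> t" "t \<le> 1" for t
    using has_gradient_directional[OF has_gradient_F[OF w[OF that]]]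
    unfolding has_field_derivative_def by (rule has_derivative_at_withinI)
  obtain t where t: "0 < t" "t < 1" "rF (?w 1) - rF (?w 0) = gradient F (?w t) \<bullet> (y - x) * (1 - 0)"
    using mvt_simple[OF zero_less_one der] by auto
  have "bd (?w t) x \<le> t * bd y x - \<mu> / 2 * t * (1 - t) * (norm (y - x))\<^sup>2"
    using strong_conv(2)[OF e, of t] t unfolding bd_def by (simp add: algebra_simps)
  also have "\<dots> \<le> t * bd y x" using t mu_pos by simp
  also have "\<dots> \<le> 1 * bd y x" using t bd_nonneg[OF x e(2)] by (intro mult_right_mono) auto
  finally have bw: "bd (?w t) x \<le> bd y x" by simp
  let ?n = "norm (gradient F (?w t) - gradient F x)" and ?b = "bd y x"
  have n1: "?n\<^sup>2 \<le> \<kappa> * ?b"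
    using gradient_F_bound[OF w x, of t] t bw kappa_pos
    by (smt (verit) mult_left_mono)
  have n2: "(norm (y - x))\<^sup>2 \<le> 2 / \<mu> * ?b"
    using bd_lower[OF x e(2)] mu_pos by (simp add: field_simps)
  have "(?n * norm (y - x))\<^sup>2 \<le> (\<kappa> * ?b) * (2 / \<mu> * ?b)"
    unfolding power_mult_distrib using n1 n2 bd_nonneg[OF x e(2)] kappa_pos by (intro mult_mono) auto
  also have "\<dots> = (sqrt (2 * \<kappa> / \<mu>) * ?b)\<^sup>2"
  proof -
    have "(sqrt (2 * \<kappa> / \<mu>))\<^sup>2 = 2 * \<kappa> / \<mu>" using kappa_pos mu_pos by simp
    then show ?thesis unfolding power_mult_distrib by (simp add: power2_eq_square)
  qed
  finally have "?n * norm (y - x) \<le> sqrt (2 * \<kappa> / \<mu>) * ?b"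
    using power2_le_imp_le bd_nonneg[OF x e(2)] kappa_pos mu_pos by (auto intro!: power2_le_imp_le)
  moreover have "(gradient F (?w t) - gradient F x) \<bullet> (y - x) \<le> ?n * norm (y - x)"
    by (rule norm_cauchy_schwarz)
  ultimately show ?thesis using t(3) by (simp add: inner_diff_left)
qed

end

lemma norm_sq_add_le_weighted:
  fixes e d :: "'a::real_inner"
  assumes "0 < \<beta>" "\<beta> < 1"
  shows "(1 - \<beta>)\<^sup>2 * (norm (e + d))\<^sup>2 \<le> (1 - \<beta>) * (norm e)\<^sup>2 + (norm d)\<^sup>2 / \<beta>"
proof -
  have "0 \<le> (1 - \<beta>) * (norm (\<beta> *\<^sub>R e - (1 - \<beta>) *\<^sub>R d))\<^sup>2" using assms by simp
  also have "\<dots> = \<beta> * ((1 - \<beta>) * (norm e)\<^sup>2) + (1 - \<beta>)\<^sup>2 * (norm d)\<^sup>2 - \<beta> * ((1 - \<beta>)\<^sup>2 * (norm (e + d))\<^sup>2)"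
    unfolding power2_norm_eq_inner
    by (simp add: inner_commute power2_eq_square algebra_simps)
  finally have 1: "\<beta> * ((1 - \<beta>)\<^sup>2 * (norm (e + d))\<^sup>2) \<le> \<beta> * ((1 - \<beta>) * (norm e)\<^sup>2) + (1 - \<beta>)\<^sup>2 * (norm d)\<^sup>2"
    by simp
  have "(1 - \<beta>)\<^sup>2 * (norm d)\<^sup>2 \<le> 1 * (norm d)\<^sup>2"
    using assms by (intro mult_right_mono) (auto simp: power_le_one)
  with 1 have "\<beta> * ((1 - \<beta>)\<^sup>2 * (norm (e + d))\<^sup>2) \<le> \<beta> * ((1 - \<beta>) * (norm e)\<^sup>2 + (norm d)\<^sup>2 / \<beta>)"
    using assms(1) by (simp add: distrib_left)
  then show ?thesis using assms(1) mult_le_cancel_left_pos by blast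
qed

lemma inner_le_weighted_norm_sq:
  fixes e d :: "'a::real_inner"
  assumes "0 < a"
  shows "- (e \<bullet> d) \<le> a * (norm e)\<^sup>2 + (norm d)\<^sup>2 / (4 * a)"
proof -
  have "0 \<le> (norm ((2 * a) *\<^sub>R e + d))\<^sup>2" by simp
  also have "\<dots> = (4 * a) * (a * (norm e)\<^sup>2 + e \<bullet> d + (norm d)\<^sup>2 / (4 * a))"
    unfolding power2_norm_eq_inner using assms
    by (simp add: inner_commute power2_eq_square algebra_simps)
  finally show ?thesis using assms by (simp add: zero_le_mult_iff)
qed

text \<open>One step of the method; \<open>\<beta>\<close> is the momentum parameter of the estimator update that follows it,
  to which the stepsize is proportional.\<close>
locale momentum_step = prox_step C \<phi> \<mu> R \<alpha> x v + bregman_lipschitz_gradient C \<phi> \<mu> F \<kappa>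
  for C :: "'d::euclidean_space set" and \<phi> \<mu> R \<alpha> x v F \<kappa> +
  fixes c \<beta> :: real
  assumes c_pos: "0 < c" and c_le: "c \<le> 1 / (2 * sqrt (\<mu> * \<kappa>))"
    and beta: "0 < \<beta>" "\<beta> < 1" and alpha_eq: "\<alpha> = c * \<mu> * \<beta>"
begin

lemma c_sq: "c\<^sup>2 * \<mu> * \<kappa> \<le> 1 / 4"
proof -
  have p: "0 < \<mu> * \<kappa>" using mu_pos kappa_pos by simp
  have "c * sqrt (\<mu> * \<kappa>) \<le> 1 / 2" using c_le p by (simp add: field_simps)
  then have "(c * sqrt (\<mu> * \<kappa>))\<^sup>2 \<le> (1 / 2)\<^sup>2" using c_pos p by (intro power_mono) auto
  moreover have "(c * sqrt (\<mu> * \<kappa>))\<^sup>2 = c\<^sup>2 * \<mu> * \<kappa>"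
    using p by (simp add: power_mult_distrib)
  moreover have "(1 / 2 :: real)\<^sup>2 = 1 / 4" by (simp add: power2_eq_square)
  ultimately show ?thesis by linarith
qed

text \<open>The stepsize condition caps the coefficient of \<open>bd z x\<close> from the descent inequality by
  \<open>3 / (4 \<alpha>)\<close> and the one from the gradient drift by \<open>1 / (4 \<alpha>)\<close>; the caps add up to the \<open>1 / \<alpha>\<close> of
  the proximal term. The inner product of \<open>v - \<nabla>F x\<close> with the displacement is absorbed by half of the
  quadratic margin of the minimizer and the part \<open>c \<beta> \<parallel>v - \<nabla>F x\<parallel>\<^sup>2\<close> of the error term.\<close>
lemma potential_decrease:
  assumes min: "is_arg_min obj (\<lambda>u. u \<in> closure C) z" and xR: "x \<in> edom R"
  shows "rF z + rR z + c * (1 - \<beta>)\<^sup>2 * (norm (v - gradient F z))\<^sup>2 + \<mu> / (8 * \<alpha>) * (norm (x - z))\<^sup>2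
    \<le> rF x + rR x + c * (norm (v - gradient F x))\<^sup>2"
proof -
  define a s where "a = bd z x" and "s = (norm (z - x))\<^sup>2"
  define e d where "e = v - gradient F x" and "d = gradient F x - gradient F z"
  have zC: "z \<in> C" using minimizer_in_C[OF min] .
  have xe: "x \<in> edom R \<inter> edom \<phi>" using xR x_in_C C_subset_edom by blast
  have a0: "0 \<le> a" unfolding a_def using bd_nonneg[OF x_in_C, of z] zC C_subset_edom by blast
  have s0: "0 \<le> s" unfolding s_def by simp
  have growth: "rR z + v \<bullet> (z - x) + a / \<alpha> + \<mu> / (2 * \<alpha>) * s \<le> rR x"
    using minimizer_growth[OF min xe] unfolding robj_def a_def s_def
    by (simp add: bd_def norm_minus_commute)
  have "sqrt (2 * \<kappa> / \<mu>) \<le> 3 / (4 * \<alpha>)"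
  proof (rule real_le_lsqrt)
    have "2 * \<kappa> / \<mu> * \<alpha>\<^sup>2 = 2 * (c\<^sup>2 * \<mu> * \<kappa>) * \<beta>\<^sup>2"
      unfolding alpha_eq using mu_pos by (simp add: field_simps power2_eq_square)
    also have "\<dots> \<le> 2 * (1 / 4) * 1"
      using c_sq beta c_pos mu_pos kappa_pos by (intro mult_mono) (auto simp: power_le_one)
    finally show "2 * \<kappa> / \<mu> \<le> (3 / (4 * \<alpha>))\<^sup>2"
      using alpha_pos by (simp add: power_divide power_mult_distrib pos_le_divide_eq)
  qed (use alpha_pos in simp)
  then have "sqrt (2 * \<kappa> / \<mu>) * a \<le> 3 / (4 * \<alpha>) * a" using a0 by (rule mult_right_mono)
  then have desc: "rF z \<le> rF x + gradient F x \<bullet> (z - x) + 3 / (4 * \<alpha>) * a"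
    using descent[OF x_in_C zC] unfolding a_def by linarith
  have "c * (1 - \<beta>)\<^sup>2 * (norm (v - gradient F z))\<^sup>2 = c * ((1 - \<beta>)\<^sup>2 * (norm (e + d))\<^sup>2)"
    unfolding e_def d_def by simp
  also have "\<dots> \<le> c * ((1 - \<beta>) * (norm e)\<^sup>2 + (norm d)\<^sup>2 / \<beta>)"
    using norm_sq_add_le_weighted[OF beta] c_pos by (intro mult_left_mono) auto
  also have "\<dots> \<le> c * ((1 - \<beta>) * (norm e)\<^sup>2 + \<kappa> * a / \<beta>)"
    using gradient_F_bound[OF zC x_in_C] c_pos beta unfolding d_def a_def
    by (intro mult_left_mono add_left_mono divide_right_mono) (auto simp: norm_minus_commute)
  also have "\<dots> = c * (1 - \<beta>) * (norm e)\<^sup>2 + c\<^sup>2 * \<mu> * \<kappa> * a / \<alpha>"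
    unfolding alpha_eq using beta c_pos mu_pos by (simp add: field_simps power2_eq_square)
  also have "c\<^sup>2 * \<mu> * \<kappa> * a / \<alpha> \<le> 1 / 4 * a / \<alpha>"
    using c_sq a0 alpha_pos by (intro divide_right_mono mult_right_mono) auto
  finally have err: "c * (1 - \<beta>)\<^sup>2 * (norm (v - gradient F z))\<^sup>2 \<le> c * (1 - \<beta>) * (norm e)\<^sup>2 + 1 / 4 * a / \<alpha>"
    by simp
  have "- (e \<bullet> (z - x)) \<le> c * \<beta> * (norm e)\<^sup>2 + s / (4 * (c * \<beta>))"
    unfolding s_def using c_pos beta by (intro inner_le_weighted_norm_sq) simp
  moreover have "s / (4 * (c * \<beta>)) = \<mu> / (4 * \<alpha>) * s" unfolding alpha_eq using mu_pos by simp
  ultimately have cross: "- (e \<bullet> (z - x)) \<le> c * \<beta> * (norm e)\<^sup>2 + \<mu> / (4 * \<alpha>) * s" by simp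
  have ex: "e \<bullet> (z - x) = v \<bullet> (z - x) - gradient F x \<bullet> (z - x)"
    unfolding e_def by (simp add: inner_diff_left)
  have f1: "3 / (4 * \<alpha>) * a = 3 / 4 * (a / \<alpha>)" "1 / 4 * a / \<alpha> = 1 / 4 * (a / \<alpha>)" by simp_all
  have f2: "\<mu> / (2 * \<alpha>) * s = 4 * (\<mu> / (8 * \<alpha>) * s)" "\<mu> / (4 * \<alpha>) * s = 2 * (\<mu> / (8 * \<alpha>) * s)" by simp_all
  have f3: "c * (1 - \<beta>) * (norm e)\<^sup>2 + c * \<beta> * (norm e)\<^sup>2 = c * (norm e)\<^sup>2" by (simp add: algebra_simps)
  have f4: "0 \<le> \<mu> / (8 * \<alpha>) * s" using mu_pos alpha_pos s0 by simp
  have f5: "(norm (x - z))\<^sup>2 = s" unfolding s_def by (simp add: norm_minus_commute)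
  show ?thesis
    unfolding f5 e_def[symmetric]
    using growth desc err cross ex f3 f4 unfolding f1 f2 by linarith
qed

end

section \<open>Conditional orthogonality and independent random indices\<close>

text \<open>If the conditional mean of \<open>Z\<close> given \<open>F\<close> vanishes and \<open>Y\<close> is \<open>F\<close>-measurable, then mixed terms
  integrate to zero; the conditional mean is taken coordinatewise. Stated as an inequality of
  nonnegative integrals, this holds even if \<open>Y\<close> or \<open>Z\<close> is not square integrable.\<close>
lemma (in prob_space) conditional_orthogonality:
  fixes Y Z :: "'a \<Rightarrow> 'd::euclidean_space"
  assumes sub: "subalgebra M F" and Y: "Y \<in> borel_measurable F" and Z: "Z \<in> borel_measurable M"
    and zero: "\<And>b. b \<in> Basis \<Longrightarrow> AE \<omega> in M. real_cond_exp M F (\<lambda>\<omega>. Z \<omega> \<bullet> b) \<omega> = 0"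
  shows "(\<integral>\<^sup>+\<omega>. ennreal ((norm (Y \<omega> + Z \<omega>))\<^sup>2) \<partial>M)
    \<le> (\<integral>\<^sup>+\<omega>. ennreal ((norm (Y \<omega>))\<^sup>2) \<partial>M) + (\<integral>\<^sup>+\<omega>. ennreal ((norm (Z \<omega>))\<^sup>2) \<partial>M)"
proof (cases "(\<integral>\<^sup>+\<omega>. ennreal ((norm (Y \<omega>))\<^sup>2) \<partial>M) < \<infinity> \<and> (\<integral>\<^sup>+\<omega>. ennreal ((norm (Z \<omega>))\<^sup>2) \<partial>M) < \<infinity>")
  case False
  then have "(\<integral>\<^sup>+\<omega>. ennreal ((norm (Y \<omega>))\<^sup>2) \<partial>M) + (\<integral>\<^sup>+\<omega>. ennreal ((norm (Z \<omega>))\<^sup>2) \<partial>M) = \<top>"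
    by (auto simp: not_less top_unique)
  then show ?thesis by (metis top_greatest)
next
  case True
  interpret finite_measure_subalgebra M F
    by unfold_locales (rule sub)
  have YM[measurable]: "Y \<in> borel_measurable M" using measurable_from_subalg[OF sub Y] .
  note Z[measurable] Y[measurable]
  have iY: "integrable M (\<lambda>\<omega>. (norm (Y \<omega>))\<^sup>2)" and iZ: "integrable M (\<lambda>\<omega>. (norm (Z \<omega>))\<^sup>2)"
    using True by (auto intro!: integrableI_bounded)
  have iP: "integrable M (\<lambda>\<omega>. (Y \<omega> \<bullet> b) * (Z \<omega> \<bullet> b))" if b: "b \<in> Basis" for b
  proof (rule Bochner_Integration.integrable_bound[OF Bochner_Integration.integrable_add[OF iY iZ]])
    show "AE \<omega> in M. norm ((Y \<omega> \<bullet> b) * (Z \<omega> \<bullet> b)) \<le> norm ((norm (Y \<omega>))\<^sup>2 + (norm (Z \<omega>))\<^sup>2)"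
    proof (rule AE_I2)
      fix \<omega>
      have "\<bar>Y \<omega> \<bullet> b\<bar> * \<bar>Z \<omega> \<bullet> b\<bar> \<le> norm (Y \<omega>) * norm (Z \<omega>)"
        by (intro mult_mono Basis_le_norm[OF b]) auto
      also have "\<dots> \<le> (norm (Y \<omega>))\<^sup>2 + (norm (Z \<omega>))\<^sup>2"
        using sum_squares_bound[of "norm (Y \<omega>)" "norm (Z \<omega>)"]
          mult_nonneg_nonneg[OF norm_ge_zero[of "Y \<omega>"] norm_ge_zero[of "Z \<omega>"]] by linarith
      finally show "norm ((Y \<omega> \<bullet> b) * (Z \<omega> \<bullet> b)) \<le> norm ((norm (Y \<omega>))\<^sup>2 + (norm (Z \<omega>))\<^sup>2)"
        by (simp add: abs_mult)
    qed
  qed simp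
  have eP: "(\<integral>\<omega>. (Y \<omega> \<bullet> b) * (Z \<omega> \<bullet> b) \<partial>M) = 0" if b: "b \<in> Basis" for b
  proof -
    have "(\<integral>\<omega>. (Y \<omega> \<bullet> b) * (Z \<omega> \<bullet> b) \<partial>M)
        = (\<integral>\<omega>. (Y \<omega> \<bullet> b) * real_cond_exp M F (\<lambda>\<omega>. Z \<omega> \<bullet> b) \<omega> \<partial>M)"
      by (rule real_cond_exp_intg(2)[symmetric]) (use iP[OF b] in auto)
    also have "\<dots> = 0"
      using zero[OF b] by (intro integral_eq_zero_AE) (auto elim!: eventually_mono)
    finally show ?thesis .
  qed
  have expand: "(norm (Y \<omega> + Z \<omega>))\<^sup>2 = (norm (Y \<omega>))\<^sup>2 + (norm (Z \<omega>))\<^sup>2 + 2 * (\<Sum>b\<in>Basis. (Y \<omega> \<bullet> b) * (Z \<omega> \<bullet> b))" for \<omega>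
    unfolding power2_norm_eq_inner euclidean_inner[of "Y \<omega>" "Z \<omega>", symmetric]
    by (simp add: algebra_simps inner_commute)
  have iE: "integrable M (\<lambda>\<omega>. (norm (Y \<omega> + Z \<omega>))\<^sup>2)"
    unfolding expand using iY iZ iP by (intro Bochner_Integration.integrable_add integrable_mult_right Bochner_Integration.integrable_sum) auto
  have "(\<integral>\<omega>. (norm (Y \<omega> + Z \<omega>))\<^sup>2 \<partial>M) = (\<integral>\<omega>. (norm (Y \<omega>))\<^sup>2 \<partial>M) + (\<integral>\<omega>. (norm (Z \<omega>))\<^sup>2 \<partial>M)"
    unfolding expand using iY iZ iP eP by simp
  then show ?thesis
    using iY iZ iE by (simp add: nn_integral_eq_integral flip: ennreal_plus)
qed

text \<open>Restricted to \<open>F\<close>, the measure with density the indicator of \<open>E\<close> is a multiple of the original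
  one.\<close>
lemma (in prob_space) nn_integral_indicator_indep:
  assumes sub: "subalgebra M F" and f: "f \<in> borel_measurable F" and E: "E \<in> sets M"
    and indep: "\<And>A. A \<in> sets F \<Longrightarrow> prob (A \<inter> E) = prob A * prob E"
  shows "(\<integral>\<^sup>+\<omega>. f \<omega> * indicator E \<omega> \<partial>M) = ennreal (prob E) * (\<integral>\<^sup>+\<omega>. f \<omega> \<partial>M)"
proof -
  have sp: "space F = space M" "sets F \<subseteq> sets M" using sub unfolding subalgebra_def by auto
  let ?D = "density M (indicator E)"
  have subD: "subalgebra ?D F" using sp unfolding subalgebra_def by simp
  have eq: "restr_to_subalg ?D F = scale_measure (ennreal (prob E)) (restr_to_subalg M F)"
  proof (rule measure_eqI)
    show "sets (restr_to_subalg ?D F) = sets (scale_measure (ennreal (prob E)) (restr_to_subalg M F))"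
      using subD sub by (simp add: sets_restr_to_subalg)
    fix A assume "A \<in> sets (restr_to_subalg ?D F)"
    then have A: "A \<in> sets F" using sets_restr_to_subalg[OF subD] by simp
    then have AM: "A \<in> sets M" using sp by auto
    have "emeasure ?D A = emeasure M (E \<inter> A)"
      using E AM by (simp add: emeasure_density nn_integral_indicator indicator_inter_arith[symmetric])
    also have "\<dots> = ennreal (prob E) * emeasure M A"
      using indep[OF A] by (simp add: emeasure_eq_measure Int_commute mult.commute flip: ennreal_mult)
    finally show "emeasure (restr_to_subalg ?D F) A
        = emeasure (scale_measure (ennreal (prob E)) (restr_to_subalg M F)) A"
      using A by (simp add: emeasure_restr_to_subalg[OF subD] emeasure_restr_to_subalg[OF sub])
  qed
  have fM: "f \<in> borel_measurable M" using measurable_from_subalg[OF sub f] .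
  have fr: "f \<in> borel_measurable (restr_to_subalg M F)" using measurable_in_subalg[OF sub f] .
  have "(\<integral>\<^sup>+\<omega>. f \<omega> * indicator E \<omega> \<partial>M) = (\<integral>\<^sup>+\<omega>. f \<omega> \<partial>?D)"
    using E fM by (simp add: nn_integral_density mult.commute)
  also have "\<dots> = (\<integral>\<^sup>+\<omega>. f \<omega> \<partial>(restr_to_subalg ?D F))"
    by (rule nn_integral_subalgebra2[OF subD f, symmetric])
  also have "\<dots> = ennreal (prob E) * (\<integral>\<^sup>+\<omega>. f \<omega> \<partial>(restr_to_subalg M F))"
    unfolding eq by (rule nn_integral_scale_measure[OF fr])
  also have "(\<integral>\<^sup>+\<omega>. f \<omega> \<partial>(restr_to_subalg M F)) = (\<integral>\<^sup>+\<omega>. f \<omega> \<partial>M)"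
    by (rule nn_integral_subalgebra2[OF sub f])
  finally show ?thesis .
qed

text \<open>Evaluating a process at an independent random time.\<close>
lemma (in prob_space) nn_integral_random_index:
  fixes h :: "nat \<Rightarrow> 'a \<Rightarrow> ennreal"
  assumes sub: "\<And>k. subalgebra M (\<F> k)" and h: "\<And>k. k < N \<Longrightarrow> h k \<in> borel_measurable (\<F> k)"
    and r: "r \<in> measurable M (count_space UNIV)"
    and indep: "\<And>k. indep_set (sets (\<F> k)) {r -` A \<inter> space M | A. True}"
    and total: "(\<Sum>k<N. prob {\<omega> \<in> space M. r \<omega> = k}) = 1"
  shows "(\<integral>\<^sup>+\<omega>. h (r \<omega>) \<omega> \<partial>M) = (\<Sum>k<N. ennreal (prob {\<omega> \<in> space M. r \<omega> = k}) * (\<integral>\<^sup>+\<omega>. h k \<omega> \<partial>M))"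
proof -
  let ?E = "\<lambda>k. {\<omega> \<in> space M. r \<omega> = k}"
  have E: "?E k \<in> sets M" for k using r by measurable
  have un: "(\<Union>k<N. ?E k) = {\<omega> \<in> space M. r \<omega> < N}" by auto
  have "prob (\<Union>k<N. ?E k) = (\<Sum>k<N. prob (?E k))"
    using E by (intro finite_measure_finite_Union) (auto simp: disjoint_family_on_def)
  then have "prob {\<omega> \<in> space M. r \<omega> < N} = 1" unfolding un total .
  then have AE: "AE \<omega> in M. r \<omega> < N"
    using r by (subst (asm) prob_Collect_eq_1) auto
  have "(\<integral>\<^sup>+\<omega>. h (r \<omega>) \<omega> \<partial>M) = (\<integral>\<^sup>+\<omega>. (\<Sum>k<N. h k \<omega> * indicator (?E k) \<omega>) \<partial>M)"
  proof (rule nn_integral_cong_AE)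
    show "AE \<omega> in M. h (r \<omega>) \<omega> = (\<Sum>k<N. h k \<omega> * indicator (?E k) \<omega>)"
      using AE AE_space
    proof eventually_elim
      case (elim \<omega>)
      have "(\<Sum>k<N. h k \<omega> * indicator (?E k) \<omega>) = (\<Sum>k<N. if k = r \<omega> then h k \<omega> else 0)"
        using elim by (intro sum.cong) (auto simp: indicator_def)
      then show ?case using elim by simp
    qed
  qed
  also have "\<dots> = (\<Sum>k<N. \<integral>\<^sup>+\<omega>. h k \<omega> * indicator (?E k) \<omega> \<partial>M)"
  proof (rule nn_integral_sum)
    fix k assume "k \<in> {..<N}"
    then have "h k \<in> borel_measurable M" using measurable_from_subalg[OF sub h] by blast
    then show "(\<lambda>\<omega>. h k \<omega> * indicator (?E k) \<omega>) \<in> borel_measurable M"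
      using E by (intro borel_measurable_times_ennreal borel_measurable_indicator)
  qed
  also have "\<dots> = (\<Sum>k<N. ennreal (prob (?E k)) * (\<integral>\<^sup>+\<omega>. h k \<omega> \<partial>M))"
  proof (intro sum.cong refl nn_integral_indicator_indep[OF sub h E])
    fix k A assume A: "A \<in> sets (\<F> k)"
    have "?E k = r -` {k} \<inter> space M" by auto
    then have "?E k \<in> {r -` A \<inter> space M | A. True}" by blast
    then show "prob (A \<inter> ?E k) = prob A * prob (?E k)"
      using indep_setD[OF indep[of k] A] by simp
  qed auto
  finally show ?thesis .
qed

lemma borel_measurable_compose_continuous_open:
  fixes g :: "'d::topological_space \<Rightarrow> 'e::real_normed_vector"
  assumes "open C" "continuous_on C g" "X \<in> borel_measurable M" "\<And>\<omega>. \<omega> \<in> space M \<Longrightarrow> X \<omega> \<in> C"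
  shows "(\<lambda>\<omega>. g (X \<omega>)) \<in> borel_measurable M"
proof -
  have "(\<lambda>y. if y \<in> C then g y else 0) \<in> borel_measurable borel"
    using assms(1,2) by (intro borel_measurable_continuous_on_if) auto
  from measurable_compose[OF assms(3) this] have "(\<lambda>\<omega>. if X \<omega> \<in> C then g (X \<omega>) else 0) \<in> borel_measurable M" .
  then show ?thesis by (rule measurable_cong[THEN iffD1, rotated]) (use assms(4) in auto)
qed

text \<open>Telescoping of a potential \<open>w + e\<close> with gains \<open>g\<close> and noise \<open>n\<close>. The error \<open>e\<close> is renewed after
  each step, so the noise of the renewal after the last step does not enter.\<close>
lemma telescope_without_last_noise:
  fixes w e p g n :: "nat \<Rightarrow> ennreal"
  assumes step: "\<And>k. w (Suc k) + p k + g k \<le> w k + e k"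
    and err: "\<And>k. e (Suc k) \<le> p k + n k"
  shows "(\<Sum>k<Suc N. g k) + w (Suc N) + p N \<le> w 0 + e 0 + (\<Sum>k<N. n k)"
proof (induction N)
  case 0
  show ?case using step[of 0] by (simp add: ac_simps)
next
  case (Suc N)
  have "(\<Sum>k<Suc (Suc N). g k) + w (Suc (Suc N)) + p (Suc N)
      = (\<Sum>k<Suc N. g k) + (w (Suc (Suc N)) + p (Suc N) + g (Suc N))" by (simp add: ac_simps)
  also have "\<dots> \<le> (\<Sum>k<Suc N. g k) + (w (Suc N) + (p N + n N))"
    by (intro add_left_mono order_trans[OF step] err)
  also have "\<dots> = ((\<Sum>k<Suc N. g k) + w (Suc N) + p N) + n N" by (simp add: ac_simps)
  also have "\<dots> \<le> (w 0 + e 0 + (\<Sum>k<N. n k)) + n N" by (intro add_right_mono Suc.IH)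
  finally show ?case by (simp add: ac_simps)
qed

section \<open>Expected progress of the method\<close>

text \<open>A run of the method from a starting point at which \<open>R\<close> is finite; \<open>P\<close> is a lower bound of the
  composite objective on the feasible part of \<open>C\<close>.\<close>
locale msbpg_run = bregman_lipschitz_gradient C \<phi> \<mu> F \<kappa> + prob_space M
  for C :: "'d::euclidean_space set" and \<phi> \<mu> F \<kappa> and M :: "'w measure" +
  fixes R :: "'d \<Rightarrow> ereal" and \<alpha> \<beta> :: "nat \<Rightarrow> real" and m :: "nat \<Rightarrow> nat"
    and c \<sigma> P :: real and \<F> :: "nat \<Rightarrow> 'w measure"
    and x0 v0 :: 'd and X V G :: "nat \<Rightarrow> 'w \<Rightarrow> 'd"
  assumes R_not_MInf: "\<And>y. R y \<noteq> -\<infinity>" and convex_R: "convex_fun R" and lsc_R: "lsc_fun R"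
    and R_feasible: "edom R \<inter> C \<noteq> {}"
    and lsc_F: "lsc_fun F" and cont_grad: "continuous_on C (gradient F)"
    and lower: "\<And>y. y \<in> C \<Longrightarrow> y \<in> edom R \<Longrightarrow> P \<le> real_of_ereal (F y) + real_of_ereal (R y)"
    and filt: "filtration (space M) \<F>" and sub: "\<And>k. subalgebra M (\<F> k)"
    and X_adapted: "\<And>k. X k \<in> borel_measurable (\<F> k)"
    and G_adapted: "\<And>k. G k \<in> borel_measurable (\<F> (Suc k))"
    and x0_in_C: "x0 \<in> C" and x0_edom: "x0 \<in> edom R"
    and beta: "\<And>k. 0 < \<beta> k" "\<And>k. \<beta> k < 1"
    and algorithm: "msbpg C \<phi> R \<alpha> \<beta> (space M) G x0 v0 X V"
    and m_pos: "\<And>k. 0 < m k" and noise: "noise_requirement M \<F> F X G \<sigma> m"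
    and c_pos: "0 < c" and c_le: "c \<le> 1 / (2 * sqrt (\<mu> * \<kappa>))"
    and alpha_eq: "\<And>k. \<alpha> k = c * \<mu> * \<beta> (Suc k)"
begin

lemma alpha_pos: "0 < \<alpha> k"
  unfolding alpha_eq using c_pos mu_pos beta by simp

lemma momentum_stepI: "x \<in> C \<Longrightarrow> momentum_step C \<phi> \<mu> R (\<alpha> k) x F \<kappa> c (\<beta> (Suc k))"
  by unfold_locales (use R_not_MInf convex_R R_feasible alpha_pos c_pos c_le beta alpha_eq in auto)

lemma prox_stepI: "x \<in> C \<Longrightarrow> prox_step C \<phi> \<mu> R (\<alpha> k) x"
  by unfold_locales (use R_not_MInf convex_R R_feasible alpha_pos in auto)

lemma initial: "\<omega> \<in> space M \<Longrightarrow> X 0 \<omega> = x0" "\<omega> \<in> space M \<Longrightarrow> V 0 \<omega> = v0"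
  using algorithm unfolding msbpg_def by auto

lemma V_Suc: "\<omega> \<in> space M \<Longrightarrow> V (Suc k) \<omega> = (1 - \<beta> (Suc k)) *\<^sub>R V k \<omega> + \<beta> (Suc k) *\<^sub>R G (Suc k) \<omega>"
  using algorithm unfolding msbpg_def by auto

lemma X_Suc:
  assumes "\<omega> \<in> space M" "X k \<omega> \<in> C"
  shows "is_arg_min (prox_step.obj \<phi> R (\<alpha> k) (X k \<omega>) (V k \<omega>)) (\<lambda>u. u \<in> closure C) (X (Suc k) \<omega>)"
proof -
  interpret prox_step C \<phi> \<mu> R "\<alpha> k" "X k \<omega>" "V k \<omega>" using prox_stepI[OF assms(2)] .
  show ?thesis using algorithm assms(1) unfolding msbpg_def obj_def[abs_def] by blast
qed

lemma X_in: "\<omega> \<in> space M \<Longrightarrow> X k \<omega> \<in> C \<and> X k \<omega> \<in> edom R"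
proof (induction k)
  case 0
  then show ?case using initial x0_in_C x0_edom by simp
next
  case (Suc k)
  then interpret prox_step C \<phi> \<mu> R "\<alpha> k" "X k \<omega>" "V k \<omega>" using prox_stepI by blast
  have "is_arg_min obj (\<lambda>u. u \<in> closure C) (X (Suc k) \<omega>)" using X_Suc Suc by blast
  then show ?case using minimizer_in_C minimizer_iff by blast
qed

lemma subalg_mono: "j \<le> k \<Longrightarrow> subalgebra (\<F> k) (\<F> j)"
  using filt unfolding filtration_def subalgebra_def by auto

text \<open>The estimator \<open>V k\<close> contains \<open>G k\<close> and is therefore known only at time \<open>Suc k\<close>.\<close>
lemma V_adapted: "V k \<in> borel_measurable (\<F> (Suc k))"
proof (induction k)
  have sp: "space (\<F> k) = space M" for k using sub[of k] unfolding subalgebra_def by simp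
  {
    case 0
    show ?case by (rule measurable_cong[THEN iffD2, of _ _ "\<lambda>_. v0"]) (auto simp: initial sp)
  next
    case (Suc k)
    have "V k \<in> borel_measurable (\<F> (Suc (Suc k)))"
      using measurable_from_subalg[OF subalg_mono Suc, of "Suc (Suc k)"] by simp
    then have "(\<lambda>\<omega>. (1 - \<beta> (Suc k)) *\<^sub>R V k \<omega> + \<beta> (Suc k) *\<^sub>R G (Suc k) \<omega>) \<in> borel_measurable (\<F> (Suc (Suc k)))"
      using G_adapted by measurable
    then show ?case by (rule measurable_cong[THEN iffD2, rotated]) (auto simp: V_Suc sp)
  }
qed

lemma gradF_adapted: "(\<lambda>\<omega>. gradient F (X k \<omega>)) \<in> borel_measurable (\<F> k)"
proof (rule borel_measurable_compose_continuous_open[OF open_C cont_grad X_adapted])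
  fix \<omega> assume "\<omega> \<in> space (\<F> k)"
  then show "X k \<omega> \<in> C" using X_in sub[of k] unfolding subalgebra_def by auto
qed

lemma measurable_M [measurable]:
  "X k \<in> borel_measurable M" "G k \<in> borel_measurable M" "V k \<in> borel_measurable M"
  "(\<lambda>\<omega>. gradient F (X k \<omega>)) \<in> borel_measurable M"
  using measurable_from_subalg[OF sub X_adapted] measurable_from_subalg[OF sub G_adapted]
    measurable_from_subalg[OF sub V_adapted] measurable_from_subalg[OF sub gradF_adapted] by auto

lemma potential_measurable [measurable]:
  "(\<lambda>\<omega>. real_of_ereal (F (X k \<omega>)) + real_of_ereal (R (X k \<omega>))) \<in> borel_measurable M"
proof -
  have [measurable]: "F \<in> borel_measurable borel" "R \<in> borel_measurable borel"
    using lsc_F lsc_R lsc_fun_borel_measurable by auto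
  show ?thesis by measurable
qed

text \<open>The stochastic error has conditional mean zero, so the squared tracking error splits.\<close>
lemma tracking_error:
  "(\<integral>\<^sup>+\<omega>. ennreal (c * (norm (V (Suc k) \<omega> - gradient F (X (Suc k) \<omega>)))\<^sup>2) \<partial>M)
    \<le> (\<integral>\<^sup>+\<omega>. ennreal (c * (1 - \<beta> (Suc k))\<^sup>2 * (norm (V k \<omega> - gradient F (X (Suc k) \<omega>)))\<^sup>2) \<partial>M)
      + ennreal ((\<alpha> k)\<^sup>2 * \<sigma>\<^sup>2 / (c * \<mu>\<^sup>2 * real (m (Suc k))))"
proof -
  let ?b = "\<beta> (Suc k)" and ?F = "\<F> (Suc k)"
  interpret S: finite_measure_subalgebra M ?F by unfold_locales (rule sub)
  define Y where "Y \<omega> = (1 - ?b) *\<^sub>R (V k \<omega> - gradient F (X (Suc k) \<omega>))" for \<omega>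
  define D where "D \<omega> = G (Suc k) \<omega> - gradient F (X (Suc k) \<omega>)" for \<omega>
  define Z where "Z \<omega> = ?b *\<^sub>R D \<omega>" for \<omega>
  have YF: "Y \<in> borel_measurable ?F" unfolding Y_def using V_adapted gradF_adapted by measurable
  have ZM: "Z \<in> borel_measurable M" unfolding Z_def D_def by measurable
  have DM [measurable]: "D \<in> borel_measurable M" unfolding D_def by measurable
  have intG: "integrable M (G (Suc k))"
    and ceG: "\<And>b. b \<in> Basis \<Longrightarrow> AE \<omega> in M. real_cond_exp M ?F (\<lambda>\<omega>. G (Suc k) \<omega> \<bullet> b) \<omega> = gradient F (X (Suc k) \<omega>) \<bullet> b"
    and var: "AE \<omega> in M. nn_cond_exp M ?F (\<lambda>\<omega>. ennreal ((norm (D \<omega>))\<^sup>2)) \<omega> \<le> ennreal (\<sigma>\<^sup>2 / real (m (Suc k)))"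
    using noise unfolding noise_requirement_def D_def by blast+
  have zero: "AE \<omega> in M. real_cond_exp M ?F (\<lambda>\<omega>. Z \<omega> \<bullet> b) \<omega> = 0" if b: "b \<in> Basis" for b
  proof -
    have iG: "integrable M (\<lambda>\<omega>. G (Suc k) \<omega> \<bullet> b)" using intG by simp
    have "integrable M (real_cond_exp M ?F (\<lambda>\<omega>. G (Suc k) \<omega> \<bullet> b))"
      by (rule S.real_cond_exp_int(1)[OF iG])
    then have iH: "integrable M (\<lambda>\<omega>. gradient F (X (Suc k) \<omega>) \<bullet> b)"
      by (rule integrable_cong_AE_imp) (use ceG[OF b] in \<open>auto elim: eventually_mono\<close>)
    have "(\<lambda>\<omega>. gradient F (X (Suc k) \<omega>) \<bullet> b) \<in> borel_measurable ?F"
      using gradF_adapted by measurable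
    from S.real_cond_exp_F_meas[OF iH this] S.real_cond_exp_diff[OF iG iH] ceG[OF b]
      S.real_cond_exp_cmult[OF Bochner_Integration.integrable_diff[OF iG iH], of ?b]
    show ?thesis
      by eventually_elim (simp add: Z_def D_def inner_diff_left)
  qed
  have "(\<integral>\<^sup>+\<omega>. ennreal ((norm (D \<omega>))\<^sup>2) \<partial>M) = (\<integral>\<^sup>+\<omega>. nn_cond_exp M ?F (\<lambda>\<omega>. ennreal ((norm (D \<omega>))\<^sup>2)) \<omega> \<partial>M)"
    using S.nn_cond_exp_intg[of "\<lambda>_. 1" "\<lambda>\<omega>. ennreal ((norm (D \<omega>))\<^sup>2)"] by simp
  also have "\<dots> \<le> (\<integral>\<^sup>+\<omega>. ennreal (\<sigma>\<^sup>2 / real (m (Suc k))) \<partial>M)"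
    using var by (rule nn_integral_mono_AE)
  also have "\<dots> = ennreal (\<sigma>\<^sup>2 / real (m (Suc k)))" by (simp add: emeasure_space_1)
  finally have Dle: "(\<integral>\<^sup>+\<omega>. ennreal ((norm (D \<omega>))\<^sup>2) \<partial>M) \<le> ennreal (\<sigma>\<^sup>2 / real (m (Suc k)))" .
  have "(\<integral>\<^sup>+\<omega>. ennreal (c * (norm (Z \<omega>))\<^sup>2) \<partial>M) = ennreal (c * ?b\<^sup>2) * (\<integral>\<^sup>+\<omega>. ennreal ((norm (D \<omega>))\<^sup>2) \<partial>M)"
    using c_pos by (subst nn_integral_cmult[symmetric])
      (auto simp: Z_def power_mult_distrib mult.assoc ennreal_mult[symmetric])
  also have "\<dots> \<le> ennreal (c * ?b\<^sup>2) * ennreal (\<sigma>\<^sup>2 / real (m (Suc k)))"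
    using Dle by (rule mult_left_mono) simp
  also have "\<dots> = ennreal (c * ?b\<^sup>2 * (\<sigma>\<^sup>2 / real (m (Suc k))))"
    using c_pos by (intro ennreal_mult'[symmetric]) simp
  also have "c * ?b\<^sup>2 * (\<sigma>\<^sup>2 / real (m (Suc k))) = (\<alpha> k)\<^sup>2 * \<sigma>\<^sup>2 / (c * \<mu>\<^sup>2 * real (m (Suc k)))"
    unfolding alpha_eq using c_pos mu_pos m_pos[of "Suc k"] by (simp add: field_simps power2_eq_square)
  finally have Zle: "(\<integral>\<^sup>+\<omega>. ennreal (c * (norm (Z \<omega>))\<^sup>2) \<partial>M) \<le> ennreal ((\<alpha> k)\<^sup>2 * \<sigma>\<^sup>2 / (c * \<mu>\<^sup>2 * real (m (Suc k))))" .
  have sc: "(\<integral>\<^sup>+\<omega>. ennreal (c * (norm (W \<omega>))\<^sup>2) \<partial>M) = ennreal c * (\<integral>\<^sup>+\<omega>. ennreal ((norm (W \<omega>))\<^sup>2) \<partial>M)"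
    if "W \<in> borel_measurable M" for W :: "'w \<Rightarrow> 'd"
    using that c_pos by (subst nn_integral_cmult[symmetric]) (auto simp: ennreal_mult[symmetric])
  have YM: "Y \<in> borel_measurable M" using measurable_from_subalg[OF sub YF] .
  have "(\<integral>\<^sup>+\<omega>. ennreal (c * (norm (V (Suc k) \<omega> - gradient F (X (Suc k) \<omega>)))\<^sup>2) \<partial>M)
      = (\<integral>\<^sup>+\<omega>. ennreal (c * (norm (Y \<omega> + Z \<omega>))\<^sup>2) \<partial>M)"
    by (intro nn_integral_cong) (simp add: V_Suc Y_def Z_def D_def algebra_simps)
  also have "\<dots> = ennreal c * (\<integral>\<^sup>+\<omega>. ennreal ((norm (Y \<omega> + Z \<omega>))\<^sup>2) \<partial>M)"
    using YM ZM by (intro sc) measurable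
  also have "\<dots> \<le> ennreal c * ((\<integral>\<^sup>+\<omega>. ennreal ((norm (Y \<omega>))\<^sup>2) \<partial>M) + (\<integral>\<^sup>+\<omega>. ennreal ((norm (Z \<omega>))\<^sup>2) \<partial>M))"
    by (intro mult_left_mono conditional_orthogonality[OF sub YF ZM zero]) auto
  also have "\<dots> = (\<integral>\<^sup>+\<omega>. ennreal (c * (norm (Y \<omega>))\<^sup>2) \<partial>M) + (\<integral>\<^sup>+\<omega>. ennreal (c * (norm (Z \<omega>))\<^sup>2) \<partial>M)"
    unfolding sc[OF YM] sc[OF ZM] by (rule distrib_left)
  also have "(\<integral>\<^sup>+\<omega>. ennreal (c * (norm (Y \<omega>))\<^sup>2) \<partial>M)
      = (\<integral>\<^sup>+\<omega>. ennreal (c * (1 - ?b)\<^sup>2 * (norm (V k \<omega> - gradient F (X (Suc k) \<omega>)))\<^sup>2) \<partial>M)"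
    by (simp add: Y_def power_mult_distrib mult.assoc)
  finally show ?thesis using Zle by (meson add_left_mono order_trans)
qed

text \<open>The pathwise decrease, integrated; nonnegativity of all terms replaces integrability.\<close>
lemma expected_decrease:
  "(\<integral>\<^sup>+\<omega>. ennreal (real_of_ereal (F (X (Suc k) \<omega>)) + real_of_ereal (R (X (Suc k) \<omega>)) - P) \<partial>M)
    + (\<integral>\<^sup>+\<omega>. ennreal (c * (1 - \<beta> (Suc k))\<^sup>2 * (norm (V k \<omega> - gradient F (X (Suc k) \<omega>)))\<^sup>2) \<partial>M)
    + (\<integral>\<^sup>+\<omega>. ennreal (\<mu> / (8 * \<alpha> k) * (norm (X k \<omega> - X (Suc k) \<omega>))\<^sup>2) \<partial>M)
    \<le> (\<integral>\<^sup>+\<omega>. ennreal (real_of_ereal (F (X k \<omega>)) + real_of_ereal (R (X k \<omega>)) - P) \<partial>M)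
      + (\<integral>\<^sup>+\<omega>. ennreal (c * (norm (V k \<omega> - gradient F (X k \<omega>)))\<^sup>2) \<partial>M)"
    (is "(\<integral>\<^sup>+\<omega>. ?w1 \<omega> \<partial>M) + (\<integral>\<^sup>+\<omega>. ?p \<omega> \<partial>M) + (\<integral>\<^sup>+\<omega>. ?g \<omega> \<partial>M)
      \<le> (\<integral>\<^sup>+\<omega>. ?w \<omega> \<partial>M) + (\<integral>\<^sup>+\<omega>. ?e \<omega> \<partial>M)")
proof -
  have pw: "?w1 \<omega> + ?p \<omega> + ?g \<omega> \<le> ?w \<omega> + ?e \<omega>" if w: "\<omega> \<in> space M" for \<omega>
  proof -
    interpret momentum_step C \<phi> \<mu> R "\<alpha> k" "X k \<omega>" "V k \<omega>" F \<kappa> c "\<beta> (Suc k)"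
      using momentum_stepI X_in[OF w] by blast
    have "is_arg_min obj (\<lambda>u. u \<in> closure C) (X (Suc k) \<omega>)" using X_Suc X_in[OF w] w by blast
    note d = potential_decrease[OF this conjunct2[OF X_in[OF w, of k]]]
    have "0 \<le> rF (X j \<omega>) + rR (X j \<omega>) - P" for j using lower X_in[OF w] by simp
    moreover have "0 \<le> c * (1 - \<beta> (Suc k))\<^sup>2 * (norm (V k \<omega> - gradient F (X (Suc k) \<omega>)))\<^sup>2"
      "0 \<le> \<mu> / (8 * \<alpha> k) * (norm (X k \<omega> - X (Suc k) \<omega>))\<^sup>2"
      "0 \<le> c * (norm (V k \<omega> - gradient F (X k \<omega>)))\<^sup>2"
      using c_pos mu_pos alpha_pos by auto
    ultimately show ?thesis
      using d by (simp add: ennreal_plus[symmetric] ennreal_leI del: ennreal_plus)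
  qed
  have "(\<integral>\<^sup>+\<omega>. ?w1 \<omega> \<partial>M) + (\<integral>\<^sup>+\<omega>. ?p \<omega> \<partial>M) + (\<integral>\<^sup>+\<omega>. ?g \<omega> \<partial>M) = (\<integral>\<^sup>+\<omega>. ?w1 \<omega> + ?p \<omega> + ?g \<omega> \<partial>M)"
    by (subst nn_integral_add, measurable)+
  also have "\<dots> \<le> (\<integral>\<^sup>+\<omega>. ?w \<omega> + ?e \<omega> \<partial>M)" using pw by (intro nn_integral_mono) auto
  also have "\<dots> = (\<integral>\<^sup>+\<omega>. ?w \<omega> \<partial>M) + (\<integral>\<^sup>+\<omega>. ?e \<omega> \<partial>M)" by (rule nn_integral_add) measurable
  finally show ?thesis .
qed

text \<open>The initial potential plus the noise of the first \<open>n\<close> estimator updates.\<close>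
definition bound :: "nat \<Rightarrow> real" where
  "bound n = (real_of_ereal (F x0) + real_of_ereal (R x0) - P) + c * (norm (v0 - gradient F x0))\<^sup>2
    + (\<Sum>k<n. (\<alpha> k)\<^sup>2 * \<sigma>\<^sup>2 / (c * \<mu>\<^sup>2 * real (m (Suc k))))"

lemma expected_displacements:
  "(\<Sum>k<Suc n. \<integral>\<^sup>+\<omega>. ennreal (\<mu> / (8 * \<alpha> k) * (norm (X k \<omega> - X (Suc k) \<omega>))\<^sup>2) \<partial>M) \<le> ennreal (bound n)"
proof -
  let ?nz = "\<lambda>k. (\<alpha> k)\<^sup>2 * \<sigma>\<^sup>2 / (c * \<mu>\<^sup>2 * real (m (Suc k)))"
  let ?W = "real_of_ereal (F x0) + real_of_ereal (R x0) - P" and ?E = "c * (norm (v0 - gradient F x0))\<^sup>2"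
  define w where "w k = (\<integral>\<^sup>+\<omega>. ennreal (real_of_ereal (F (X k \<omega>)) + real_of_ereal (R (X k \<omega>)) - P) \<partial>M)" for k
  define e where "e k = (\<integral>\<^sup>+\<omega>. ennreal (c * (norm (V k \<omega> - gradient F (X k \<omega>)))\<^sup>2) \<partial>M)" for k
  define p where "p k = (\<integral>\<^sup>+\<omega>. ennreal (c * (1 - \<beta> (Suc k))\<^sup>2 * (norm (V k \<omega> - gradient F (X (Suc k) \<omega>)))\<^sup>2) \<partial>M)" for k
  define g where "g k = (\<integral>\<^sup>+\<omega>. ennreal (\<mu> / (8 * \<alpha> k) * (norm (X k \<omega> - X (Suc k) \<omega>))\<^sup>2) \<partial>M)" for k
  have "(\<Sum>k<Suc n. g k) \<le> (\<Sum>k<Suc n. g k) + w (Suc n) + p n" by (simp add: add.assoc)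
  also have "\<dots> \<le> w 0 + e 0 + (\<Sum>k<n. ennreal (?nz k))"
    using expected_decrease tracking_error unfolding w_def e_def p_def g_def
    by (rule telescope_without_last_noise)
  finally have "(\<Sum>k<Suc n. \<integral>\<^sup>+\<omega>. ennreal (\<mu> / (8 * \<alpha> k) * (norm (X k \<omega> - X (Suc k) \<omega>))\<^sup>2) \<partial>M)
    \<le> (\<integral>\<^sup>+\<omega>. ennreal (real_of_ereal (F (X 0 \<omega>)) + real_of_ereal (R (X 0 \<omega>)) - P) \<partial>M)
      + (\<integral>\<^sup>+\<omega>. ennreal (c * (norm (V 0 \<omega> - gradient F (X 0 \<omega>)))\<^sup>2) \<partial>M) + (\<Sum>k<n. ennreal (?nz k))"
    unfolding w_def e_def g_def .
  also have "(\<integral>\<^sup>+\<omega>. ennreal (real_of_ereal (F (X 0 \<omega>)) + real_of_ereal (R (X 0 \<omega>)) - P) \<partial>M) = (\<integral>\<^sup>+\<omega>. ennreal ?W \<partial>M)"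
    by (intro nn_integral_cong) (simp add: initial)
  also have "(\<integral>\<^sup>+\<omega>. ennreal (c * (norm (V 0 \<omega> - gradient F (X 0 \<omega>)))\<^sup>2) \<partial>M) = (\<integral>\<^sup>+\<omega>. ennreal ?E \<partial>M)"
    by (intro nn_integral_cong) (simp add: initial)
  also have "(\<integral>\<^sup>+\<omega>. ennreal ?W \<partial>M) + (\<integral>\<^sup>+\<omega>. ennreal ?E \<partial>M) + (\<Sum>k<n. ennreal (?nz k)) = ennreal (bound n)"
  proof -
    have nz: "0 \<le> ?nz k" for k using c_pos by simp
    have "0 \<le> ?W" "0 \<le> ?E" using lower[OF x0_in_C x0_edom] c_pos by auto
    then show ?thesis using nz unfolding bound_def
      by (simp add: emeasure_space_1 sum_ennreal sum_nonneg ennreal_plus[symmetric] del: ennreal_plus)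
  qed
  finally show ?thesis .
qed

lemma bregman_grad_map_eq:
  assumes w: "\<omega> \<in> space M"
  shows "bregman_grad_map C \<phi> R (\<alpha> k) (V k \<omega>) (X k \<omega>) = (1 / \<alpha> k) *\<^sub>R (X k \<omega> - X (Suc k) \<omega>)"
proof -
  interpret prox_step C \<phi> \<mu> R "\<alpha> k" "X k \<omega>" "V k \<omega>" using prox_stepI X_in[OF w] by blast
  have "is_arg_min obj (\<lambda>u. u \<in> closure C) (X (Suc k) \<omega>)" using X_Suc X_in[OF w] w by blast
  from prox_eq_minimizer[OF this] show ?thesis unfolding bregman_grad_map_def by simp
qed

lemma random_iterate_bound:
  assumes r: "r \<in> measurable M (count_space UNIV)"
    and dist: "\<And>k. k < Suc n \<Longrightarrow> prob {\<omega> \<in> space M. r \<omega> = k} = \<alpha> k / (\<Sum>j<Suc n. \<alpha> j)"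
    and indep: "\<And>k. indep_set (sets (\<F> k)) {r -` A \<inter> space M | A. True}"
  shows "(\<integral>\<^sup>+\<omega>. ennreal ((norm (bregman_grad_map C \<phi> R (\<alpha> (r \<omega>)) (V (r \<omega>) \<omega>) (X (r \<omega>) \<omega>)))\<^sup>2) \<partial>M)
    \<le> ennreal (bound n / (\<Sum>k<Suc n. \<mu> * \<alpha> k / 8))"
proof -
  let ?S = "\<Sum>j<Suc n. \<alpha> j"
  have S: "0 < ?S" using alpha_pos by (intro sum_pos) auto
  define h where "h k \<omega> = ennreal ((norm ((1 / \<alpha> k) *\<^sub>R (X k \<omega> - X (Suc k) \<omega>)))\<^sup>2)" for k \<omega>
  have hm: "h k \<in> borel_measurable (\<F> (Suc k))" for k
  proof -
    have "X k \<in> borel_measurable (\<F> (Suc k))"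
      using measurable_from_subalg[OF subalg_mono X_adapted, of k "Suc k"] by simp
    then show ?thesis unfolding h_def using X_adapted[of "Suc k"] by measurable
  qed
  have tot: "(\<Sum>k<Suc n. prob {\<omega> \<in> space M. r \<omega> = k}) = 1"
  proof -
    have "(\<Sum>k<Suc n. prob {\<omega> \<in> space M. r \<omega> = k}) = (\<Sum>k<Suc n. \<alpha> k / ?S)"
      by (intro sum.cong) (auto simp: dist)
    also have "\<dots> = 1" using S by (simp add: sum_divide_distrib[symmetric] del: sum.lessThan_Suc)
    finally show ?thesis .
  qed
  have "(\<integral>\<^sup>+\<omega>. ennreal ((norm (bregman_grad_map C \<phi> R (\<alpha> (r \<omega>)) (V (r \<omega>) \<omega>) (X (r \<omega>) \<omega>)))\<^sup>2) \<partial>M)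
      = (\<integral>\<^sup>+\<omega>. h (r \<omega>) \<omega> \<partial>M)"
    by (intro nn_integral_cong) (simp add: bregman_grad_map_eq h_def)
  \<comment> \<open>\<open>h k\<close> involves \<open>X (Suc k)\<close>, hence the shift by one in the filtration.\<close>
  also have "\<dots> = (\<Sum>k<Suc n. ennreal (prob {\<omega> \<in> space M. r \<omega> = k}) * (\<integral>\<^sup>+\<omega>. h k \<omega> \<partial>M))"
    by (rule nn_integral_random_index[where \<F> = "\<lambda>k. \<F> (Suc k)", OF sub hm r indep tot])
  also have "\<dots> = (\<Sum>k<Suc n. ennreal (8 / (\<mu> * ?S)) * (\<integral>\<^sup>+\<omega>. ennreal (\<mu> / (8 * \<alpha> k) * (norm (X k \<omega> - X (Suc k) \<omega>))\<^sup>2) \<partial>M))"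
  proof (rule sum.cong[OF refl])
    fix k assume "k \<in> {..<Suc n}"
    then have p: "prob {\<omega> \<in> space M. r \<omega> = k} = \<alpha> k / ?S" using dist by simp
    have eq: "\<alpha> k / ?S * (norm ((1 / \<alpha> k) *\<^sub>R (X k \<omega> - X (Suc k) \<omega>)))\<^sup>2
        = 8 / (\<mu> * ?S) * (\<mu> / (8 * \<alpha> k) * (norm (X k \<omega> - X (Suc k) \<omega>))\<^sup>2)" for \<omega>
    proof -
      have "norm ((1 / \<alpha> k) *\<^sub>R (X k \<omega> - X (Suc k) \<omega>)) = norm (X k \<omega> - X (Suc k) \<omega>) / \<alpha> k"
        using alpha_pos[of k] by simp
      then show ?thesis using alpha_pos[of k] mu_pos S
        by (simp add: power_divide power2_eq_square del: sum.lessThan_Suc norm_scaleR)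
    qed
    have "ennreal (\<alpha> k / ?S) * (\<integral>\<^sup>+\<omega>. h k \<omega> \<partial>M) = (\<integral>\<^sup>+\<omega>. ennreal (\<alpha> k / ?S * (norm ((1 / \<alpha> k) *\<^sub>R (X k \<omega> - X (Suc k) \<omega>)))\<^sup>2) \<partial>M)"
    proof -
      have "ennreal (\<alpha> k / ?S) * (\<integral>\<^sup>+\<omega>. h k \<omega> \<partial>M) = (\<integral>\<^sup>+\<omega>. ennreal (\<alpha> k / ?S) * h k \<omega> \<partial>M)"
        by (rule nn_integral_cmult[symmetric]) (rule measurable_from_subalg[OF sub hm])
      also have "\<dots> = (\<integral>\<^sup>+\<omega>. ennreal (\<alpha> k / ?S * (norm ((1 / \<alpha> k) *\<^sub>R (X k \<omega> - X (Suc k) \<omega>)))\<^sup>2) \<partial>M)"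
        unfolding h_def using alpha_pos[of k] S
        by (intro nn_integral_cong ennreal_mult'[symmetric]) (simp del: sum.lessThan_Suc)
      finally show ?thesis .
    qed
    also have "\<dots> = ennreal (8 / (\<mu> * ?S)) * (\<integral>\<^sup>+\<omega>. ennreal (\<mu> / (8 * \<alpha> k) * (norm (X k \<omega> - X (Suc k) \<omega>))\<^sup>2) \<partial>M)"
    proof -
      have "(\<integral>\<^sup>+\<omega>. ennreal (\<alpha> k / ?S * (norm ((1 / \<alpha> k) *\<^sub>R (X k \<omega> - X (Suc k) \<omega>)))\<^sup>2) \<partial>M)
          = (\<integral>\<^sup>+\<omega>. ennreal (8 / (\<mu> * ?S)) * ennreal (\<mu> / (8 * \<alpha> k) * (norm (X k \<omega> - X (Suc k) \<omega>))\<^sup>2) \<partial>M)"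
        unfolding eq using S mu_pos
        by (intro nn_integral_cong ennreal_mult') (simp del: sum.lessThan_Suc)
      also have "\<dots> = ennreal (8 / (\<mu> * ?S)) * (\<integral>\<^sup>+\<omega>. ennreal (\<mu> / (8 * \<alpha> k) * (norm (X k \<omega> - X (Suc k) \<omega>))\<^sup>2) \<partial>M)"
        by (rule nn_integral_cmult) measurable
      finally show ?thesis .
    qed
    finally show "ennreal (prob {\<omega> \<in> space M. r \<omega> = k}) * (\<integral>\<^sup>+\<omega>. h k \<omega> \<partial>M)
        = ennreal (8 / (\<mu> * ?S)) * (\<integral>\<^sup>+\<omega>. ennreal (\<mu> / (8 * \<alpha> k) * (norm (X k \<omega> - X (Suc k) \<omega>))\<^sup>2) \<partial>M)"
      unfolding p .
  qed
  also have "\<dots> \<le> ennreal (8 / (\<mu> * ?S)) * ennreal (bound n)"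
    unfolding sum_distrib_left[symmetric] by (intro mult_left_mono expected_displacements) simp
  also have "\<dots> = ennreal (8 / (\<mu> * ?S) * bound n)"
    using mu_pos S by (intro ennreal_mult'[symmetric]) (simp del: sum.lessThan_Suc)
  also have "8 / (\<mu> * ?S) * bound n = bound n / (\<Sum>k<Suc n. \<mu> * \<alpha> k / 8)"
    unfolding sum_divide_distrib[symmetric] sum_distrib_left[symmetric] by simp
  finally show ?thesis .
qed

end

section \<open>The bound for the stochastic Bregman gradient mapping\<close>

theorem theorem24:
  fixes C :: "'d::euclidean_space set"
    and \<Xi> :: "'x measure" and f :: "'d \<Rightarrow> 'x \<Rightarrow> ereal"
    and F R \<phi> \<Phi> :: "'d \<Rightarrow> ereal" and \<Phi>_star :: ereal
    and L_F \<mu> \<kappa> c \<sigma> :: real and \<alpha> \<beta> :: "nat \<Rightarrow> real" and m :: "nat \<Rightarrow> nat"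
    and M :: "'w measure" and \<F> :: "nat \<Rightarrow> 'w measure"
    and x0 v0 :: 'd and X V G :: "nat \<Rightarrow> 'w \<Rightarrow> 'd"
    and N :: nat and r :: "'w \<Rightarrow> nat"
  assumes C: "C \<noteq> {}" "convex C" "open C"
    and objective: "expectation_objective C \<Xi> f F"
    and \<Phi>: "\<Phi> = (\<lambda>x. F x + R x)"
    and \<Phi>_star: "\<Phi>_star = (INF x\<in>closure C. \<Phi> x)"
    and A1: "proper_fun F" "lsc_fun F" "edom \<phi> \<subseteq> edom F" "C1_fun_on (interior C) F"
    and A2: "\<phi> \<in> kernel_class C" "legendre_kernel \<phi>"
      "\<mu> > 0" "strongly_convex_fun \<mu> \<phi>" "smooth_adaptable C L_F \<phi> F"
    and A3: "proper_fun R" "lsc_fun R" "convex_fun R" "edom R \<inter> interior C \<noteq> {}"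
    and A4: "\<Phi>_star > -\<infinity>"
    and prob: "prob_space M" "filtration (space M) \<F>" "\<forall>k. subalgebra M (\<F> k)"
    and adapted: "\<forall>k. X k \<in> borel_measurable (\<F> k)" "\<forall>k. G k \<in> borel_measurable (\<F> (Suc k))"
    and x0: "x0 \<in> C"
    and \<beta>: "\<forall>k. 0 < \<beta> k \<and> \<beta> k < 1"
    and algorithm: "msbpg C \<phi> R \<alpha> \<beta> (space M) G x0 v0 X V"
    and noise: "\<forall>k. 0 < m k" "noise_requirement M \<F> F X G \<sigma> m"
    and \<kappa>: "\<kappa> > 0"
      "\<forall>x\<in>edom \<phi>. \<forall>y\<in>interior (edom \<phi>). differentiable_pt F x \<longrightarrow>
         ereal ((norm (gradient F x - gradient F y))\<^sup>2) \<le> ereal \<kappa> * bregman \<phi> x y"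
    and c: "0 < c" "c \<le> 1 / (2 * sqrt (\<mu> * \<kappa>))"
    and \<alpha>: "\<forall>k. \<alpha> k = c * \<mu> * \<beta> (Suc k)"
    and N: "N \<ge> 1"
    and r: "r \<in> measurable M (count_space UNIV)"
      "\<forall>k<N. measure M {\<omega>\<in>space M. r \<omega> = k} = \<alpha> k / (\<Sum>j<N. \<alpha> j)"
      "\<forall>k. prob_space.indep_set M (sets (\<F> k)) {r -` A \<inter> space M | A. True}"
  shows
    "enn2ereal (\<integral>\<^sup>+\<omega>. ennreal ((norm
         (bregman_grad_map C \<phi> R (\<alpha> (r \<omega>)) (V (r \<omega>) \<omega>) (X (r \<omega>) \<omega>)))\<^sup>2) \<partial>M)
       \<le> ((\<Phi> x0 - \<Phi>_star) + ereal (c * (norm (v0 - gradient F x0))\<^sup>2)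
            + ereal (\<Sum>k<N. (\<alpha> k)\<^sup>2 * \<sigma>\<^sup>2 / (c * \<mu>\<^sup>2 * real (m (Suc k)))))
         / ereal (\<Sum>k<N. \<mu> * \<alpha> k / 8)
     \<and> ((\<forall>k. Suc k < N \<longrightarrow> m k \<le> m (Suc k)) \<longrightarrow>
         enn2ereal (\<integral>\<^sup>+\<omega>. ennreal ((norm
           (bregman_grad_map C \<phi> R (\<alpha> (r \<omega>)) (V (r \<omega>) \<omega>) (X (r \<omega>) \<omega>)))\<^sup>2) \<partial>M)
         \<le> ((\<Phi> x0 - \<Phi>_star) + ereal (c * (norm (v0 - gradient F x0))\<^sup>2)
              + ereal (\<Sum>k<N. (\<alpha> k)\<^sup>2 * \<sigma>\<^sup>2 / (c * \<mu>\<^sup>2 * real (m k))))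
           / ereal (\<Sum>k<N. \<mu> * \<alpha> k / 8))"
proof -
  interpret pr: prob_space M by (rule prob(1))
  have Cint: "interior C = C" using C(3) by (rule interior_open)
  have kern: "strong_kernel C \<phi> \<mu>" by unfold_locales (use C A2 in auto)
  interpret K: strong_kernel C \<phi> \<mu> by (rule kern)
  have Fgrad: "has_gradient F (gradient F y) y" if "y \<in> C" for y
    using A1(4) that unfolding Cint C1_fun_on_def by (intro has_gradient_gradient) blast
  have Ffin: "F y = ereal (real_of_ereal (F y))" if "y \<in> C" for y
  proof -
    have "\<bar>F y\<bar> \<noteq> \<infinity>" using Fgrad[OF that] subsetD[OF interior_subset, of y] unfolding has_gradient_def by fastforce
    then show ?thesis by (simp add: ereal_real)
  qed
  have Rninf: "R y \<noteq> -\<infinity>" for y using A3(1) unfolding proper_fun_def by blast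
  have Rfin: "R y = ereal (real_of_ereal (R y))" if "y \<in> edom R" for y
    using Rninf[of y] that unfolding edom_def by (cases "R y") auto
  have feas: "edom R \<inter> C \<noteq> {}" using A3(4) unfolding Cint .
  have \<Phi>_fin: "\<Phi> y = ereal (real_of_ereal (F y) + real_of_ereal (R y))" if y: "y \<in> C" "y \<in> edom R" for y
  proof -
    obtain a b where "F y = ereal a" "R y = ereal b" using Ffin[OF y(1)] Rfin[OF y(2)] by blast
    then show ?thesis unfolding \<Phi> by simp
  qed
  have star_le: "\<Phi>_star \<le> \<Phi> y" if "y \<in> C" for y
    unfolding \<Phi>_star using that closure_subset by (intro INF_lower) blast
  obtain P where P: "\<Phi>_star = ereal P"
  proof -
    obtain y where "y \<in> C" "y \<in> edom R" using feas by blast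
    then have "\<Phi>_star \<le> ereal (real_of_ereal (F y) + real_of_ereal (R y))" using star_le \<Phi>_fin by metis
    then show thesis using A4 that by (cases \<Phi>_star) auto
  qed
  have \<alpha>_pos: "0 < \<alpha> k" for k using \<alpha> c(1) A2(3) \<beta> by simp
  let ?S = "\<Sum>k<N. \<mu> * \<alpha> k / 8"
  have S: "0 < ?S" using N \<alpha>_pos A2(3) by (intro sum_pos) (auto simp: lessThan_empty_iff)
  let ?I = "\<integral>\<^sup>+\<omega>. ennreal ((norm (bregman_grad_map C \<phi> R (\<alpha> (r \<omega>)) (V (r \<omega>) \<omega>) (X (r \<omega>) \<omega>)))\<^sup>2) \<partial>M"
  let ?T = "\<lambda>b. ((\<Phi> x0 - \<Phi>_star) + ereal (c * (norm (v0 - gradient F x0))\<^sup>2) + ereal b) / ereal ?S"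
  obtain n where n: "N = Suc n" using N by (cases N) auto
  let ?nz = "\<lambda>k j. (\<alpha> k)\<^sup>2 * \<sigma>\<^sup>2 / (c * \<mu>\<^sup>2 * real (m j))"
  \<comment> \<open>Only the first \<open>n = N - 1\<close> noise terms are needed. If \<open>R x0\<close> is infinite, so is the right-hand
      side.\<close>
  have key: "enn2ereal ?I \<le> ?T b" if b: "(\<Sum>k<n. ?nz k (Suc k)) \<le> b" for b
  proof (cases "x0 \<in> edom R")
    case False
    then have "R x0 = \<infinity>" unfolding edom_def by simp
    then have "\<Phi> x0 = \<infinity>" using Ffin[OF x0] unfolding \<Phi> by (metis plus_ereal.simps(2) PInfty_neq_ereal(1) ereal_plus_eq_PInfty)
    then show ?thesis using S unfolding P by simp
  next
    case True
    interpret msbpg_run C \<phi> \<mu> F \<kappa> M R \<alpha> \<beta> m c \<sigma> P \<F> x0 v0 X V G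
    proof (intro msbpg_run.intro msbpg_run_axioms.intro bregman_lipschitz_gradient.intro
        bregman_lipschitz_gradient_axioms.intro kern)
      fix y x assume yx: "y \<in> C" "x \<in> C"
      have "differentiable_pt F y" using Fgrad[OF yx(1)] unfolding differentiable_pt_def by blast
      then have "ereal ((norm (gradient F y - gradient F x))\<^sup>2) \<le> ereal \<kappa> * bregman \<phi> y x"
        using \<kappa>(2) yx K.C_subset_edom K.interior_edom by blast
      then show "(norm (gradient F y - gradient F x))\<^sup>2 \<le> \<kappa> * K.bd y x"
        using K.bregman_eq[of y x] yx K.C_subset_edom by auto
    next
      fix y assume "y \<in> C" "y \<in> edom R"
      then show "P \<le> real_of_ereal (F y) + real_of_ereal (R y)"
        using star_le[of y] \<Phi>_fin unfolding P by auto
    next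
      show "continuous_on C (gradient F)" using A1(4) unfolding Cint C1_fun_on_def by blast
    qed (use Fgrad \<kappa>(1) Rninf A3 feas A1 prob adapted x0 True \<beta> algorithm noise c \<alpha> in auto)
    have "?I \<le> ennreal (bound n / (\<Sum>k<Suc n. \<mu> * \<alpha> k / 8))"
      by (rule random_iterate_bound) (use r in \<open>auto simp: n\<close>)
    then have "enn2ereal ?I \<le> enn2ereal (ennreal (bound n / ?S))" unfolding n by (simp add: less_eq_ennreal.rep_eq)
    also have "\<dots> = ereal (bound n / ?S)"
    proof -
      have "0 \<le> real_of_ereal (F x0) + real_of_ereal (R x0) - P" using lower[OF x0 True] by simp
      moreover have "0 \<le> ?nz k (Suc k)" for k using c(1) by simp
      ultimately have "0 \<le> bound n" unfolding bound_def using c(1) by (intro add_nonneg_nonneg sum_nonneg) auto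
      then show ?thesis using S by (intro enn2ereal_ennreal) simp
    qed
    also have "\<dots> \<le> ereal ((real_of_ereal (F x0) + real_of_ereal (R x0) - P + c * (norm (v0 - gradient F x0))\<^sup>2 + b) / ?S)"
      using b S unfolding bound_def by (auto intro!: divide_right_mono)
    also have "\<dots> = ?T b" unfolding \<Phi>_fin[OF x0 True] P using S by simp
    finally show ?thesis .
  qed
  have nz: "0 \<le> ?nz k j" for k j using c(1) by simp
  show ?thesis
  proof (intro conjI impI)
    show "enn2ereal ?I \<le> ?T (\<Sum>k<N. ?nz k (Suc k))" by (rule key) (use nz in \<open>simp add: n\<close>)
    \<comment> \<open>The assumption compares \<open>m k\<close> with \<open>m (Suc k)\<close> exactly for the \<open>k < n\<close> that occur.\<close>
    assume mono: "\<forall>k. Suc k < N \<longrightarrow> m k \<le> m (Suc k)"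
    have "(\<Sum>k<n. ?nz k (Suc k)) \<le> (\<Sum>k<n. ?nz k k)"
      using mono noise(1) c(1) A2(3) unfolding n
      by (intro sum_mono divide_left_mono mult_left_mono) auto
    also have "\<dots> \<le> (\<Sum>k<N. ?nz k k)" using nz by (simp add: n)
    finally show "enn2ereal ?I \<le> ?T (\<Sum>k<N. ?nz k k)" by (rule key)
  qed
qed

end
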